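(* In the reward setting described in the context, assume the threshold satisfies $B\ge\mu^*/2$. Then the (expected pseudo-)regret incurred by the subroutine RSE run with elimination threshold $B$ is at most $$\sum_{i:\Delta_i>0}\frac{289\log T}{\Delta_i}+12\min\{\bar d,\;D\Delta_{\max}\}\log K .$$
   Context: Delay-as-payoff bandit: there are $K$ arms, a horizon $T$ and a maximum delay $D\in\mathbb{N}$. Each arm $i\in[K]$ has an unknown distribution $\mathcal{D}_i$ supported on $\{0,1,\dots,D\}$. At each step $t$ the agent chooses an arm $i_t$ based on feedback observed so far, and a delay $d_t\sim\mathcal{D}_{i_t}$ is drawn independently; $d_t$ is revealed only at time $t+d_t$. The payoff of step $t$ is the reward $r_t=d_t/D$, to be maximized. Let $\mu(i)=\mathbb{E}_{X\sim\mathcal{D}_i}[X/D]$, $d(i)=D\mu(i)$, $\mu^*=\max_i\mu(i)$ attained at a unique arm $i^*$, $\Delta_i=\mu^*-\mu(i)$, $\Delta_{\max}=\max_i\Delta_i$, and $\bar d$ the second largest value among $d(1),\dots,d(K)$. Regret is $\mathbb{E}[\sum_t\Delta_{i_t}]$ over the steps played. Notation at time $t$: $n_t(i)$ is the number of steps $s\le t$ with $i_s=i$; $M_t(i)=\{s\le t: i_s=i,\ s+d_s\ge t\}$; $\mathcal{O}_t(i)=\{s\le t: i_s=i,\ s+d_s<t\}$; $F_t(i)=\{s\le t-D: i_s=i\}$; $a\vee b=\max\{a,b\}$. RSE (Reward Successive Elimination) with inputs $T$, $K$, $D$, threshold $B$: start with $t=1$ and $S=[K]$. While $t<T$: play each arm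 of $S$ once (round robin), observe arriving feedback, set $t\leftarrow t+|S|$; for each $i\in S$ compute $\hat\mu^+_t(i)=\frac{1}{n_t(i)}\big(|M_t(i)|+\sum_{s\in\mathcal{O}_t(i)}r_s\big)$, $U^1_t(i)=\hat\mu^+_t(i)+\sqrt{2\log T/n_t(i)}$, $\hat\mu^F_t(i)=\frac{1}{|F_t(i)|\vee1}\sum_{s\in F_t(i)}r_s$, $U^2_t(i)=\hat\mu^F_t(i)+\sqrt{2\log T/(|F_t(i)|\vee1)}$, $UCB_t(i)=\min\{U^1_t(i),U^2_t(i)\}$, $LCB_t(i)=\hat\mu^F_t(i)-\sqrt{2\log T/(|F_t(i)|\vee1)}$. Then remove from $S$ every arm $i$ for which some $j\in S$ has $\max\{LCB_t(j),B\}>UCB_t(i)$; if $S=\emptyset$ return (Fail, $t$). If the loop ends return (Success, $t$). *)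

theory Defs
  imports "HOL-Probability.Probability"
begin

text \<open>Arms are 1..K. Delay distributions: Dist :: nat => nat pmf.
 The randomness is a table Y :: (nat * nat) => nat, where Y (t, i) is the delay
 that would be drawn at step t if arm i were played; all entries independent,
 Y (t,i) ~ Dist i. The realised delay of step t is d_t = Y (t, i_t).
 A history h :: nat list records the arms played: i_s = h ! (s - 1), s = 1..length h.\<close>

definition arm_at :: "nat list \<Rightarrow> nat \<Rightarrow> nat" where
  "arm_at h s = h ! (s - 1)"

definition delay_at :: "(nat \<times> nat \<Rightarrow> nat) \<Rightarrow> nat list \<Rightarrow> nat \<Rightarrow> nat" where
  "delay_at Y h s = Y (s, arm_at h s)"

definition rew_at :: "nat \<Rightarrow> (nat \<times> nat \<Rightarrow> nat) \<Rightarrow> nat list \<Rightarrow> nat \<Rightarrow> real" where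
  "rew_at D Y h s = real (delay_at Y h s) / real D"

text \<open>Quantities at time t = length h + 1 (steps 1..length h have been played).\<close>

definition n_cnt :: "nat list \<Rightarrow> nat \<Rightarrow> nat" where
  "n_cnt h i = card {s \<in> {1..length h}. arm_at h s = i}"

definition M_set :: "(nat \<times> nat \<Rightarrow> nat) \<Rightarrow> nat list \<Rightarrow> nat \<Rightarrow> nat set" where
  "M_set Y h i = {s \<in> {1..length h}. arm_at h s = i \<and> s + delay_at Y h s \<ge> length h + 1}"

definition O_set :: "(nat \<times> nat \<Rightarrow> nat) \<Rightarrow> nat list \<Rightarrow> nat \<Rightarrow> nat set" where
  "O_set Y h i = {s \<in> {1..length h}. arm_at h s = i \<and> s + delay_at Y h s < length h + 1}"

definition F_set :: "nat \<Rightarrow> nat list \<Rightarrow> nat \<Rightarrow> nat set" where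
  "F_set D h i = {s \<in> {1..length h}. arm_at h s = i \<and> s + D \<le> length h + 1}"

definition mu_plus :: "nat \<Rightarrow> (nat \<times> nat \<Rightarrow> nat) \<Rightarrow> nat list \<Rightarrow> nat \<Rightarrow> real" where
  "mu_plus D Y h i = (real (card (M_set Y h i)) + (\<Sum>s\<in>O_set Y h i. rew_at D Y h s)) / real (n_cnt h i)"

definition U1 :: "nat \<Rightarrow> nat \<Rightarrow> (nat \<times> nat \<Rightarrow> nat) \<Rightarrow> nat list \<Rightarrow> nat \<Rightarrow> real" where
  "U1 T D Y h i = mu_plus D Y h i + sqrt (2 * ln (real T) / real (n_cnt h i))"

definition F_cnt :: "nat \<Rightarrow> nat list \<Rightarrow> nat \<Rightarrow> nat" where
  "F_cnt D h i = max (card (F_set D h i)) 1"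

definition mu_F :: "nat \<Rightarrow> (nat \<times> nat \<Rightarrow> nat) \<Rightarrow> nat list \<Rightarrow> nat \<Rightarrow> real" where
  "mu_F D Y h i = (\<Sum>s\<in>F_set D h i. rew_at D Y h s) / real (F_cnt D h i)"

definition U2 :: "nat \<Rightarrow> nat \<Rightarrow> (nat \<times> nat \<Rightarrow> nat) \<Rightarrow> nat list \<Rightarrow> nat \<Rightarrow> real" where
  "U2 T D Y h i = mu_F D Y h i + sqrt (2 * ln (real T) / real (F_cnt D h i))"

definition UCB :: "nat \<Rightarrow> nat \<Rightarrow> (nat \<times> nat \<Rightarrow> nat) \<Rightarrow> nat list \<Rightarrow> nat \<Rightarrow> real" where
  "UCB T D Y h i = min (U1 T D Y h i) (U2 T D Y h i)"

definition LCB :: "nat \<Rightarrow> nat \<Rightarrow> (nat \<times> nat \<Rightarrow> nat) \<Rightarrow> nat list \<Rightarrow> nat \<Rightarrow> real" where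
  "LCB T D Y h i = mu_F D Y h i - sqrt (2 * ln (real T) / real (F_cnt D h i))"

definition rse_step :: "nat \<Rightarrow> nat \<Rightarrow> real \<Rightarrow> (nat \<times> nat \<Rightarrow> nat)
    \<Rightarrow> nat list \<times> nat set \<times> bool \<Rightarrow> nat list \<times> nat set \<times> bool" where
  "rse_step T D B Y st = (case st of (h, S, stop) \<Rightarrow>
     if stop \<or> \<not> (length h + 1 < T) then (h, S, True)
     else (let h' = h @ sorted_list_of_set S;
               S' = {i \<in> S. \<not> (\<exists>j\<in>S. max (LCB T D Y h' j) B > UCB T D Y h' i)}
           in (h', S', S' = {})))"

text \<open>Each non-stopped iteration plays at least one step, so T iterations suffice
 to reach termination of the loop (t >= T) or Fail (S empty).\<close>

definition rse_history :: "nat \<Rightarrow> nat \<Rightarrow> nat \<Rightarrow> real \<Rightarrow> (nat \<times> nat \<Rightarrow> nat) \<Rightarrow> nat list" where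
  "rse_history T K D B Y = fst ((rse_step T D B Y ^^ T) ([], {1..K}, False))"

definition delay_table :: "nat \<Rightarrow> nat \<Rightarrow> (nat \<Rightarrow> nat pmf) \<Rightarrow> (nat \<times> nat \<Rightarrow> nat) pmf" where
  "delay_table T K Dist = Pi_pmf ({1..T + K} \<times> {1..K}) 0 (\<lambda>(t, i). Dist i)"

definition mean_rew :: "nat \<Rightarrow> (nat \<Rightarrow> nat pmf) \<Rightarrow> nat \<Rightarrow> real" where
  "mean_rew D Dist i = measure_pmf.expectation (Dist i) (\<lambda>x. real x / real D)"

definition mu_star :: "nat \<Rightarrow> nat \<Rightarrow> (nat \<Rightarrow> nat pmf) \<Rightarrow> real" where
  "mu_star K D Dist = Max (mean_rew D Dist ` {1..K})"

definition gap :: "nat \<Rightarrow> nat \<Rightarrow> (nat \<Rightarrow> nat pmf) \<Rightarrow> nat \<Rightarrow> real" where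
  "gap K D Dist i = mu_star K D Dist - mean_rew D Dist i"

definition gap_max :: "nat \<Rightarrow> nat \<Rightarrow> (nat \<Rightarrow> nat pmf) \<Rightarrow> real" where
  "gap_max K D Dist = Max (gap K D Dist ` {1..K})"

definition mean_delay :: "nat \<Rightarrow> (nat \<Rightarrow> nat pmf) \<Rightarrow> nat \<Rightarrow> real" where
  "mean_delay D Dist i = real D * mean_rew D Dist i"

definition dbar :: "nat \<Rightarrow> nat \<Rightarrow> (nat \<Rightarrow> nat pmf) \<Rightarrow> real" where
  "dbar K D Dist = Max {mean_delay D Dist i | i. i \<in> {1..K} \<and>
        mean_delay D Dist i < Max (mean_delay D Dist ` {1..K})}"

definition rse_regret :: "nat \<Rightarrow> nat \<Rightarrow> nat \<Rightarrow> real \<Rightarrow> (nat \<Rightarrow> nat pmf) \<Rightarrow> real" where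
  "rse_regret T K D B Dist = measure_pmf.expectation (delay_table T K Dist)
     (\<lambda>Y. \<Sum>i\<leftarrow>rse_history T K D B Y. gap K D Dist i)"

end

theory Submission
  imports Defs
begin

text \<open>
  The delay read at the \<open>k\<close>-th play of an arm sits at a random time, but the policy is
  nonanticipating, so exponential moments of these delays form a supermartingale and Hoeffding's
  inequality holds as for independent samples. Outside an event of probability at most \<open>1/T\<close> all
  confidence bounds are therefore valid.

  Let an arm \<open>i\<close> of gap \<open>\<Delta>\<close> survive \<open>r\<close> rounds, and let \<open>j\<close> arms be left. All but about \<open>D/j\<close> of
  its plays are fully observed, so comparing \<open>U2\<close> with the lower bound of the best arm (or with \<open>B\<close>,
  if the best arm is gone, since then \<open>B \<ge> \<mu>*\<close>) gives \<open>r \<le> 32 ln T / \<Delta>^2 + D/j + 1\<close>. If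
  \<open>\<mu> i \<ge> \<mu>*/6\<close>, then \<open>D \<Delta> \<le> 5 d(i)\<close>. Otherwise only about \<open>d(i)/j\<close> plays are still
  missing, and \<open>U1 \<ge> B \<ge> \<mu>*/2\<close> forces \<open>r \<mu>* \<le> 6 + 6 d(i)/j + 72 ln T / \<mu>*\<close>. In both
  cases the delay costs at most \<open>6 min(d(i), D \<Delta>)/j\<close>, and the sum of \<open>1/j\<close> over the suboptimal
  arms is at most the harmonic number of \<open>K - 1\<close>, which is at most \<open>2 ln K\<close>.
\<close>

section \<open>Hoeffding bounds for adaptively chosen samples\<close>

text \<open>Splitting off coordinate \<open>x\<close> makes its old value disappear under the
  redraw, and commuting the two draws restores the product law. This replaces conditioning on all
  entries except \<open>x\<close>.\<close>

lemma Pi_pmf_resample: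
  assumes "finite A" "x \<in> A"
  shows "Pi_pmf A d p = bind_pmf (Pi_pmf A d p) (\<lambda>Y. map_pmf (\<lambda>y. Y(x := y)) (p x))"
proof -
  have A: "A = insert x (A - {x})" "finite (A - {x})" using assms by auto
  have *: "Pi_pmf A d p = map_pmf (\<lambda>(y,f). f(x:=y)) (pair_pmf (p x) (Pi_pmf (A - {x}) d p))"
    using Pi_pmf_insert[OF A(2), of x d p] A(1) by auto
  have "bind_pmf (Pi_pmf A d p) (\<lambda>Y. map_pmf (\<lambda>y. Y(x := y)) (p x))
      = bind_pmf (Pi_pmf (A - {x}) d p) (\<lambda>f. map_pmf (\<lambda>y. f(x := y)) (p x))"
    unfolding * by (simp add: pair_pmf_def map_pmf_def bind_assoc_pmf bind_return_pmf)
  also have "\<dots> = bind_pmf (p x) (\<lambda>y. bind_pmf (Pi_pmf (A - {x}) d p) (\<lambda>f. return_pmf (f(x := y))))"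
    unfolding map_pmf_def by (rule bind_commute_pmf)
  also have "\<dots> = Pi_pmf A d p"
    unfolding * by (simp add: pair_pmf_def map_pmf_def bind_assoc_pmf bind_return_pmf)
  finally show ?thesis by simp
qed

text \<open>Times are 1-based and in increasing order, so \<open>plays h i ! k\<close> is the time
  of play number \<open>k\<close> of arm \<open>i\<close>, counted from 0.\<close>

definition plays :: "nat list \<Rightarrow> nat \<Rightarrow> nat list" where
  "plays h i = filter (\<lambda>s. arm_at h s = i) [1..<Suc (length h)]"

lemma plays_Nil [simp]: "plays [] i = []"
  by (simp add: plays_def)

lemma plays_snoc: "plays (h @ [a]) i = plays h i @ (if a = i then [Suc (length h)] else [])"
proof -
  have "filter (\<lambda>s. arm_at (h @ [a]) s = i) [1..<Suc (length h)] = plays h i"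
    unfolding plays_def arm_at_def by (intro filter_cong) (auto simp: nth_append)
  then show ?thesis by (simp add: plays_def arm_at_def nth_append)
qed

lemma set_plays: "set (plays h i) = {s \<in> {1..length h}. arm_at h s = i}"
  by (auto simp: plays_def)

lemma distinct_plays: "distinct (plays h i)"
  by (simp add: plays_def)

lemma length_plays: "length (plays h i) = count_list h i"
  by (induction h rule: rev_induct) (auto simp: plays_snoc)

lemma plays_append:
  "plays (h @ h') i = plays h i @ map (\<lambda>s. s + length h) (plays h' i)"
proof (induction h' rule: rev_induct)
  case (snoc x xs)
  show ?case
    using plays_snoc[of "h @ xs" x i] snoc by (simp add: plays_snoc)
qed simp

lemma plays_take_Suc:
  "plays (take (Suc s) h) i
     = plays (take s h) i @ (if s < length h \<and> h ! s = i then [Suc s] else [])"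
proof (cases "s < length h")
  case True
  then show ?thesis by (simp add: take_Suc_conv_app_nth plays_snoc)
qed simp

text \<open>The arm of step \<open>s\<close> may depend on every delay drawn at an earlier step,
  even one not yet revealed. This is weaker than using arrived feedback only, and it suffices for
  the supermartingale.\<close>

definition nonanticipating :: "((nat \<times> nat \<Rightarrow> nat) \<Rightarrow> nat list) \<Rightarrow> bool" where
  "nonanticipating h \<longleftrightarrow> (\<forall>s Y Y'. (\<forall>t a. t < s \<longrightarrow> Y (t, a) = Y' (t, a)) \<longrightarrow>
     take s (h Y) = take s (h Y'))"

lemma nonanticipatingD:
  assumes "nonanticipating h" "\<And>t a. t < s \<Longrightarrow> Y (t, a) = Y' (t, a)"
  shows "take s (h Y) = take s (h Y')"
  using assms unfolding nonanticipating_def by blast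

text \<open>The new factor of step \<open>Suc s\<close> reads an entry on which neither the choice
  of that arm nor the earlier factors depend, so averaging over it multiplies by at most 1. Factors
  are indexed by the play number because \<open>trunc_rew\<close> changes from play to play;
  \<open>min n\<close> freezes the product after \<open>n\<close> plays.\<close>

lemma adaptive_product_le_1:
  fixes g :: "nat \<Rightarrow> nat \<Rightarrow> ennreal"
  assumes A: "finite A" and h: "nonanticipating h"
    and i: "\<And>s. s \<in> {1..L} \<Longrightarrow> (s, i) \<in> A"
    and g: "\<And>s k. s \<in> {1..L} \<Longrightarrow> (\<integral>\<^sup>+x. g k x \<partial>measure_pmf (p (s, i))) \<le> 1"
    and "s \<le> L"
  shows "(\<integral>\<^sup>+Y. (\<Prod>k<min n (length (plays (take s (h Y)) i)). g k (Y (plays (take s (h Y)) i ! k, i)))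
           \<partial>measure_pmf (Pi_pmf A d p)) \<le> 1"
  using \<open>s \<le> L\<close>
proof (induction s)
  case 0
  then show ?case by simp
next
  case (Suc s)
  define P where "P s Y = (\<Prod>k<min n (length (plays (take s (h Y)) i)). g k (Y (plays (take s (h Y)) i ! k, i)))"
    for s Y
  define x where "x = (Suc s, i)"
  define c where "c Y \<longleftrightarrow> s < length (h Y) \<and> h Y ! s = i \<and> length (plays (take s (h Y)) i) < n" for Y
  have x: "x \<in> A" and gx: "\<And>k. (\<integral>\<^sup>+y. g k y \<partial>measure_pmf (p x)) \<le> 1"
    using Suc.prems i g by (auto simp: x_def)
  have P_Suc: "P (Suc s) Y = P s Y * (if c Y then g (length (plays (take s (h Y)) i)) (Y x) else 1)" for Y
  proof -
    let ?l = "length (plays (take s (h Y)) i)"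
    show ?thesis
    proof (cases "s < length (h Y) \<and> h Y ! s = i")
      case hit: True
      show ?thesis
      proof (cases "?l < n")
        case True
        then have "min n (Suc ?l) = Suc ?l" "min n ?l = ?l" by auto
        then show ?thesis using hit True
          by (auto simp: P_def plays_take_Suc c_def x_def nth_append intro!: arg_cong2[where f="(*)"] prod.cong)
      next
        case False
        then have "min n (Suc ?l) = n" "min n ?l = n" by auto
        then show ?thesis using hit False
          by (auto simp: P_def plays_take_Suc c_def x_def nth_append intro!: prod.cong)
      qed
    qed (auto simp: P_def plays_take_Suc c_def)
  qed
  \<comment> \<open>Entry \<open>x\<close> belongs to time \<open>Suc s\<close>, so changing it
    leaves the arms of the steps up to \<open>Suc s\<close> as they were.\<close>
  have take_upd: "take (Suc s) (h (Y(x := y))) = take (Suc s) (h Y)" for Y y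
    by (rule nonanticipatingD[OF h]) (auto simp: x_def)
  then have take_upd': "take s (h (Y(x := y))) = take s (h Y)" for Y y
    by (metis min.absorb1 le_SucI order_refl take_take)
  have c_upd: "c (Y(x := y)) = c Y" for Y y
  proof -
    have "s < length (h Y) \<and> h Y ! s = i \<longleftrightarrow> s < length (take (Suc s) (h Y)) \<and> take (Suc s) (h Y) ! s = i" for Y
      by auto
    then show ?thesis unfolding c_def take_upd' by (metis take_upd)
  qed
  have P_upd: "P s (Y(x := y)) = P s Y" for Y y
  proof -
    have "plays (take s (h Y)) i ! k \<noteq> Suc s" if "k < length (plays (take s (h Y)) i)" for k
      using nth_mem[OF that] unfolding set_plays by auto
    then show ?thesis unfolding P_def take_upd' by (intro prod.cong) (auto simp: x_def)
  qed
  have "(\<integral>\<^sup>+Y. P (Suc s) Y \<partial>Pi_pmf A d p)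
      = (\<integral>\<^sup>+Y. \<integral>\<^sup>+y. P (Suc s) (Y(x := y)) \<partial>measure_pmf (p x) \<partial>Pi_pmf A d p)"
    by (subst Pi_pmf_resample[OF A x]) simp
  also have "\<dots> \<le> (\<integral>\<^sup>+Y. P s Y \<partial>Pi_pmf A d p)"
  proof (rule nn_integral_mono)
    fix Y
    have "(\<integral>\<^sup>+y. P (Suc s) (Y(x := y)) \<partial>measure_pmf (p x))
        = P s Y * (\<integral>\<^sup>+y. (if c Y then g (length (plays (take s (h Y)) i)) y else 1) \<partial>measure_pmf (p x))"
      unfolding P_Suc P_upd c_upd take_upd' fun_upd_same by (subst nn_integral_cmult[symmetric]) auto
    also have "\<dots> \<le> P s Y * 1"
      by (intro mult_left_mono, cases "c Y") (use gx in simp_all)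
    finally show "(\<integral>\<^sup>+y. P (Suc s) (Y(x := y)) \<partial>measure_pmf (p x)) \<le> P s Y" by simp
  qed
  also have "\<dots> \<le> 1" using Suc unfolding P_def by simp
  finally show ?case unfolding P_def .
qed

text \<open>Chernoff's method, with the adaptive product in place of the moment generating function
  of a sum. Requiring \<open>n\<close> plays inside the event avoids conditioning on the random
  number of plays.\<close>

lemma adaptive_hoeffding:
  fixes f :: "nat \<Rightarrow> nat \<Rightarrow> real"
  assumes A: "finite A" and h: "nonanticipating h" and len: "\<And>Y. length (h Y) \<le> L"
    and i: "\<And>s. s \<in> {1..L} \<Longrightarrow> (s, i) \<in> A"
    and p: "\<And>s. s \<in> {1..L} \<Longrightarrow> p (s, i) = q"
    and f: "\<And>k x. x \<in> set_pmf q \<Longrightarrow> f k x \<in> {0..1}"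
    and eps: "\<epsilon> > 0"
  shows "measure_pmf.prob (Pi_pmf A d p)
     {Y. n \<le> length (plays (h Y) i) \<and>
         (\<Sum>k<n. f k (Y (plays (h Y) i ! k, i))) \<ge> measure_pmf.expectation q (\<lambda>x. \<Sum>k<n. f k x) + real n * \<epsilon>}
     \<le> exp (- 2 * real n * \<epsilon>\<^sup>2)" (is "measure_pmf.prob ?M ?E \<le> _")
proof -
  define m where "m k = measure_pmf.expectation q (f k)" for k
  \<comment> \<open>\<open>4 * \<epsilon>\<close> maximises
    \<open>l * \<epsilon> - l\<^sup>2 / 8\<close>; the maximum is
    \<open>2 * \<epsilon>\<^sup>2\<close>.\<close>
  define l where "l = 4 * \<epsilon>"
  define g where "g k x = ennreal (exp (l * (f k x - m k) - l\<^sup>2 / 8))" for k x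
  define Q where "Q Y = (\<Prod>k<min n (length (plays (h Y) i)). g k (Y (plays (h Y) i ! k, i)))" for Y
  have l: "l > 0" using eps by (simp add: l_def)
  have int: "integrable (measure_pmf q) (f k)" for k
    by (rule measure_pmf.integrable_const_bound[where B = 1])
       (use f in \<open>auto simp: AE_measure_pmf_iff\<close>)
  have g1: "(\<integral>\<^sup>+x. g k x \<partial>measure_pmf q) \<le> 1" for k
  proof -
    interpret interval_bounded_random_variable "measure_pmf q" "f k" 0 1
      by unfold_locales (use f in \<open>auto simp: AE_measure_pmf_iff\<close>)
    have "(\<integral>\<^sup>+x. g k x \<partial>measure_pmf q)
        = (\<integral>\<^sup>+x. ennreal (exp (- (l\<^sup>2 / 8))) * ennreal (exp (l * (f k x - m k))) \<partial>measure_pmf q)"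
      unfolding g_def by (simp add: ennreal_mult[symmetric] exp_add[symmetric])
    also have "\<dots> = ennreal (exp (- (l\<^sup>2 / 8))) * (\<integral>\<^sup>+x. ennreal (exp (l * (f k x - m k))) \<partial>measure_pmf q)"
      by (rule nn_integral_cmult) simp
    also have "\<dots> \<le> ennreal (exp (- (l\<^sup>2 / 8))) * ennreal (exp (l\<^sup>2 * (1 - 0)\<^sup>2 / 8))"
      unfolding m_def by (intro mult_left_mono Hoeffdings_lemma_nn_integral[OF l]) simp
    also have "\<dots> = 1" by (simp add: ennreal_mult[symmetric] exp_minus)
    finally show ?thesis .
  qed
  have Q: "(\<integral>\<^sup>+Y. Q Y \<partial>?M) \<le> 1"
  proof -
    have "(\<integral>\<^sup>+Y. (\<Prod>k<min n (length (plays (take L (h Y)) i)). g k (Y (plays (take L (h Y)) i ! k, i))) \<partial>?M) \<le> 1"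
      by (rule adaptive_product_le_1[OF A h i, of L]) (use g1 p in auto)
    then show ?thesis using len by (simp add: Q_def)
  qed
  have msum: "measure_pmf.expectation q (\<lambda>x. \<Sum>k<n. f k x) = (\<Sum>k<n. m k)"
    unfolding m_def by (rule Bochner_Integration.integral_sum) (rule int)
  \<comment> \<open>Markov's inequality in pointwise form: on the event, \<open>Q\<close> is at
    least \<open>exp (2 * real n * \<epsilon>\<^sup>2)\<close>.\<close>
  have "indicator ?E Y \<le> ennreal (exp (- 2 * real n * \<epsilon>\<^sup>2)) * Q Y" for Y
  proof (cases "Y \<in> ?E")
    case True
    let ?x = "\<lambda>k. f k (Y (plays (h Y) i ! k, i))"
    have n: "min n (length (plays (h Y) i)) = n" using True by simp
    have "Q Y = ennreal (exp (l * ((\<Sum>k<n. ?x k) - (\<Sum>k<n. m k)) - real n * l\<^sup>2 / 8))"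
      unfolding Q_def n g_def
      by (subst prod_ennreal) (simp_all add: exp_sum[symmetric] sum_subtractf sum_distrib_left[symmetric])
    then have "ennreal (exp (- 2 * real n * \<epsilon>\<^sup>2)) * Q Y
        = ennreal (exp (l * ((\<Sum>k<n. ?x k) - (\<Sum>k<n. m k)) - real n * l\<^sup>2 / 8 - 2 * real n * \<epsilon>\<^sup>2))"
      by (simp add: ennreal_mult[symmetric] exp_add[symmetric])
    moreover have "l * (real n * \<epsilon>) \<le> l * ((\<Sum>k<n. ?x k) - (\<Sum>k<n. m k))"
      using True l unfolding msum by (intro mult_left_mono) auto
    then have "0 \<le> l * ((\<Sum>k<n. ?x k) - (\<Sum>k<n. m k)) - real n * l\<^sup>2 / 8 - 2 * real n * \<epsilon>\<^sup>2"
      by (simp add: l_def power2_eq_square algebra_simps)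
    ultimately show ?thesis using True by simp
  qed simp
  then have "(\<integral>\<^sup>+Y. indicator ?E Y \<partial>?M) \<le> (\<integral>\<^sup>+Y. ennreal (exp (- 2 * real n * \<epsilon>\<^sup>2)) * Q Y \<partial>?M)"
    by (rule nn_integral_mono)
  moreover have "(\<integral>\<^sup>+Y. indicator ?E Y \<partial>?M) = emeasure ?M ?E"
    by (rule nn_integral_indicator) simp
  ultimately have "emeasure ?M ?E \<le> (\<integral>\<^sup>+Y. ennreal (exp (- 2 * real n * \<epsilon>\<^sup>2)) * Q Y \<partial>?M)"
    by simp
  also have "\<dots> \<le> ennreal (exp (- 2 * real n * \<epsilon>\<^sup>2)) * 1"
    by (subst nn_integral_cmult) (use mult_left_mono[OF Q] in auto)
  finally show ?thesis
    by (simp add: measure_pmf.emeasure_eq_measure)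
qed

section \<open>Rounds of the elimination algorithm\<close>

lemma UCB_LCB_cong:
  assumes "\<And>t a. t \<le> length h \<Longrightarrow> Y (t, a) = Y' (t, a)"
  shows "UCB T D Y h i = UCB T D Y' h i" "LCB T D Y h i = LCB T D Y' h i"
proof -
  have d: "delay_at Y h s = delay_at Y' h s" if "s \<le> length h" for s
    using assms[OF that] by (simp add: delay_at_def)
  have M: "M_set Y h i = M_set Y' h i" and O: "O_set Y h i = O_set Y' h i"
    unfolding M_set_def O_set_def by (intro Collect_cong; use d in force)+
  have r: "(\<Sum>s\<in>A. rew_at D Y h s) = (\<Sum>s\<in>A. rew_at D Y' h s)" if "A \<subseteq> {1..length h}" for A
    by (intro sum.cong) (use d that in \<open>auto simp: rew_at_def\<close>)
  have rO: "(\<Sum>s\<in>O_set Y h i. rew_at D Y h s) = (\<Sum>s\<in>O_set Y' h i. rew_at D Y' h s)"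
    unfolding O by (rule r) (auto simp: O_set_def)
  have F: "(\<Sum>s\<in>F_set D h i. rew_at D Y h s) = (\<Sum>s\<in>F_set D h i. rew_at D Y' h s)"
    by (rule r) (auto simp: F_set_def)
  show "UCB T D Y h i = UCB T D Y' h i" "LCB T D Y h i = LCB T D Y' h i"
    unfolding UCB_def LCB_def U1_def U2_def mu_plus_def mu_F_def M rO F by simp_all
qed

definition rse_state :: "nat \<Rightarrow> nat \<Rightarrow> nat \<Rightarrow> real \<Rightarrow> (nat \<times> nat \<Rightarrow> nat) \<Rightarrow> nat \<Rightarrow> nat list \<times> nat set \<times> bool" where
  "rse_state T K D B Y r = (rse_step T D B Y ^^ r) ([], {1..K}, False)"

lemma rse_state_0 [simp]: "rse_state T K D B Y 0 = ([], {1..K}, False)"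
  and rse_state_Suc: "rse_state T K D B Y (Suc r) = rse_step T D B Y (rse_state T K D B Y r)"
  by (simp_all add: rse_state_def)

lemma rse_history_eq: "rse_history T K D B Y = fst (rse_state T K D B Y T)"
  by (simp add: rse_history_def rse_state_def)

lemma rse_step_prefix: "\<exists>h. fst (rse_step T D B Y st) = fst st @ h"
  by (cases st) (auto simp: rse_step_def Let_def)

text \<open>The arms of a round are fixed when it begins; only the elimination after it reads new
  entries. If the round ends before time \<open>s\<close>, these entries agree; otherwise the
  history has already reached length \<open>s\<close>, and a different elimination no longer
  matters.\<close>

lemma rse_step_agree:
  assumes "\<And>t a. t < s \<Longrightarrow> Y (t, a) = Y' (t, a)"
  shows "rse_step T D B Y st = rse_step T D B Y' st \<or>
    s \<le> length (fst (rse_step T D B Y st)) \<and> fst (rse_step T D B Y st) = fst (rse_step T D B Y' st)"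
proof -
  obtain h S stop where st: "st = (h, S, stop)" by (cases st) auto
  let ?h = "h @ sorted_list_of_set S"
  show ?thesis
  proof (cases "length ?h < s")
    case True
    have "UCB T D Y ?h = UCB T D Y' ?h" "LCB T D Y ?h = LCB T D Y' ?h"
      by (intro ext UCB_LCB_cong; use True assms in force)+
    then show ?thesis by (simp add: st rse_step_def)
  next
    case False
    then show ?thesis by (auto simp: st rse_step_def Let_def)
  qed
qed

lemma nonanticipating_rse: "nonanticipating (rse_history T K D B)"
  unfolding nonanticipating_def
proof (intro allI impI)
  fix s Y Y' assume *: "\<forall>t a. t < s \<longrightarrow> Y (t, a) = (Y' :: nat \<times> nat \<Rightarrow> nat) (t, a)"
  let ?a = "rse_state T K D B Y" and ?b = "rse_state T K D B Y'"
  have "?a r = ?b r \<or> s \<le> length (fst (?a r)) \<and> s \<le> length (fst (?b r)) \<and>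
      take s (fst (?a r)) = take s (fst (?b r))" for r
  proof (induction r)
    case (Suc r)
    then show ?case
    proof
      assume "?a r = ?b r"
      then show ?thesis
        using rse_step_agree[of s Y Y' T D B "?b r"] * unfolding rse_state_Suc by auto
    next
      assume "s \<le> length (fst (?a r)) \<and> s \<le> length (fst (?b r)) \<and>
        take s (fst (?a r)) = take s (fst (?b r))"
      then show ?thesis
        using rse_step_prefix[of T D B Y "?a r"] rse_step_prefix[of T D B Y' "?b r"]
        unfolding rse_state_Suc by auto
    qed
  qed simp
  from this[of T] show "take s (rse_history T K D B Y) = take s (rse_history T K D B Y')"
    unfolding rse_history_eq by auto
qed

lemma distinct_count_list_one: "distinct xs \<Longrightarrow> x \<in> set xs \<Longrightarrow> count_list xs x = 1"
  by (induction xs) (auto simp: count_list_0_iff)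

section \<open>Round structure along a fixed delay table\<close>

locale rse_run =
  fixes T K D :: nat and B :: real and Y :: "nat \<times> nat \<Rightarrow> nat"
  assumes K: "K \<ge> 1"
begin

definition H :: "nat \<Rightarrow> nat list" where "H r = fst (rse_state T K D B Y r)"
definition S :: "nat \<Rightarrow> nat set" where "S r = fst (snd (rse_state T K D B Y r))"
text \<open>Separates the rounds that are really played, counted from 0, from the idle iterations
  after the loop has ended.\<close>

definition act :: "nat \<Rightarrow> bool" where
  "act r \<longleftrightarrow> \<not> snd (snd (rse_state T K D B Y r)) \<and> length (H r) + 1 < T"

lemma H_0 [simp]: "H 0 = []" and S_0 [simp]: "S 0 = {1..K}"
  by (simp_all add: H_def S_def)

lemma H_Suc: "H (Suc r) = (if act r then H r @ sorted_list_of_set (S r) else H r)"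
  by (auto simp: H_def S_def act_def rse_state_Suc rse_step_def Let_def split: prod.splits)

lemma S_Suc: "S (Suc r) = (if act r then {i \<in> S r. \<not> (\<exists>j\<in>S r. max (LCB T D Y (H (Suc r)) j) B > UCB T D Y (H (Suc r)) i)} else S r)"
  by (auto simp: H_def S_def act_def rse_state_Suc rse_step_def Let_def split: prod.splits)

lemma act_Suc: "act (Suc r) \<Longrightarrow> act r \<and> S (Suc r) \<noteq> {}"
  by (auto simp: H_def S_def act_def rse_state_Suc rse_step_def Let_def split: prod.splits if_splits)

lemma act_mono: "act r \<Longrightarrow> k \<le> r \<Longrightarrow> act k"
  by (induction r) (auto simp: le_Suc_eq dest: act_Suc)

lemma S_antimono: "k \<le> r \<Longrightarrow> S r \<subseteq> S k"
  by (rule lift_Suc_antimono_le[of S]) (auto simp: S_Suc)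

lemma S_subset: "S r \<subseteq> {1..K}"
  using S_antimono[of 0 r] by simp

lemma finite_S [simp]: "finite (S r)"
  using S_subset finite_subset by blast

lemma card_S: "card (S r) \<le> K"
  using card_mono[OF _ S_subset, of r] by simp

lemma card_S_pos: "act r \<Longrightarrow> card (S r) \<ge> 1"
  using K act_Suc by (cases r) (auto simp: Suc_le_eq card_gt_0_iff)

text \<open>A round begins only before the horizon and adds at most \<open>K\<close> steps, so all
  plays stay within the rows of the delay table.\<close>

lemma length_H: "length (H r) \<le> T + K"
proof (induction r)
  case (Suc r)
  then show ?case using card_S[of r] by (auto simp: H_Suc act_def)
qed simp

lemma length_H_act: "act r \<Longrightarrow> r \<le> length (H r)"
proof (induction r)
  case (Suc r)
  then have "act r" using act_Suc by blast
  then show ?case using Suc.IH card_S_pos[of r] by (simp add: H_Suc)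
qed simp

lemma act_less: "act r \<Longrightarrow> r + 1 < T"
  using length_H_act[of r] by (simp add: act_def)

text \<open>The arm sets shrink, so each of the rounds \<open>k\<close> to \<open>r - 1\<close>
  takes at least \<open>card (S r)\<close> steps. This exchange rate between rounds and time
  produces every quotient of a delay by a number of arms.\<close>

lemma length_H_diff:
  assumes "act r" "k \<le> r"
  shows "length (H k) + (r - k) * card (S r) \<le> length (H r)"
  using assms
proof (induction r)
  case (Suc r)
  show ?case
  proof (cases "k = Suc r")
    case False
    have a: "act r" using Suc.prems act_Suc by blast
    have c: "card (S (Suc r)) \<le> card (S r)"
      by (intro card_mono S_antimono) auto
    have "length (H k) + (r - k) * card (S (Suc r)) \<le> length (H k) + (r - k) * card (S r)"
      using c by simp
    also have "\<dots> \<le> length (H r)" using Suc a False by simp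
    finally show ?thesis using False Suc.prems c a by (simp add: H_Suc Suc_diff_le)
  qed simp
qed simp

text \<open>Meaningful only in an active round with \<open>i\<close> in \<open>S r\<close>, where it
  is the time at which that round plays \<open>i\<close>.\<close>

definition pos :: "nat \<Rightarrow> nat \<Rightarrow> nat" where
  "pos i r = hd (plays (sorted_list_of_set (S r)) i) + length (H r)"

lemma plays_sorted:
  assumes "i \<in> S r"
  shows "plays (sorted_list_of_set (S r)) i = [hd (plays (sorted_list_of_set (S r)) i)]"
proof -
  have "length (plays (sorted_list_of_set (S r)) i) = 1"
    using assms by (simp add: length_plays distinct_count_list_one)
  then show ?thesis by (cases "plays (sorted_list_of_set (S r)) i") auto
qed

lemma plays_H_Suc:
  "plays (H (Suc r)) i = plays (H r) i @ (if act r \<and> i \<in> S r then [pos i r] else [])"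
proof (cases "act r \<and> i \<in> S r")
  case True
  then show ?thesis using plays_sorted[of i r] 
    by (simp add: H_Suc plays_append pos_def) (metis list.simps(8,9))
next
  case False
  have "plays (sorted_list_of_set (S r)) i = []" if "i \<notin> S r"
    using that by (auto simp: length_plays count_list_0_iff simp flip: length_0_conv)
  then show ?thesis using False by (auto simp: H_Suc plays_append)
qed

lemma pos_bounds:
  assumes "act r" "i \<in> S r"
  shows "length (H r) < pos i r" "pos i r \<le> length (H (Suc r))"
proof -
  have "hd (plays (sorted_list_of_set (S r)) i) \<in> set (plays (sorted_list_of_set (S r)) i)"
    using plays_sorted[OF assms(2)] by (metis list.set_intros(1))
  then show "length (H r) < pos i r" "pos i r \<le> length (H (Suc r))"
    using assms unfolding set_plays by (auto simp: pos_def H_Suc)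
qed

text \<open>Activity of rounds and membership in \<open>S\<close> are never regained, so an arm is
  played in an initial segment of rounds. Play number \<open>k\<close> thus takes place in round
  \<open>k\<close>, and the two numberings are interchangeable below.\<close>

lemma less_length_plays: "k < length (plays (H r) i) \<longleftrightarrow> k < r \<and> act k \<and> i \<in> S k"
proof (induction r arbitrary: k)
  case (Suc r)
  show ?case
  proof (cases "act r \<and> i \<in> S r")
    case True
    then have *: "act k \<and> i \<in> S k" if "k \<le> r" for k
      using act_mono[of r k] S_antimono[of k r] that by auto
    have "r \<le> length (plays (H r) i)"
      using Suc.IH[of "r - 1"] *[of "r - 1"] by (cases r) auto
    moreover have "\<not> r < length (plays (H r) i)" using Suc.IH[of r] by simp
    ultimately show ?thesis using True * by (auto simp: plays_H_Suc less_Suc_eq_le)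
  qed (use Suc in \<open>auto simp: plays_H_Suc less_Suc_eq\<close>)
qed simp

lemma length_plays_le: "length (plays (H r) i) \<le> r"
  by (rule ccontr) (use less_length_plays[of r r i] in auto)

lemma plays_H: "plays (H r) i = map (pos i) [0..<length (plays (H r) i)]"
proof (induction r)
  case (Suc r)
  have "length (plays (H r) i) = r" if "act r" "i \<in> S r"
  proof -
    have "\<not> length (plays (H r) i) < r"
    proof
      assume l: "length (plays (H r) i) < r"
      then have "act (length (plays (H r) i))" "i \<in> S (length (plays (H r) i))"
        using that act_mono[of r] S_antimono[of _ r] by (auto dest: less_imp_le)
      then show False using less_length_plays[of "length (plays (H r) i)" r i] l by simp
    qed
    then show ?thesis using length_plays_le[of r i] by simp
  qed
  then show ?case using Suc by (auto simp: plays_H_Suc)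
qed simp

lemma length_plays_H:
  assumes "act r" "i \<in> S r" shows "length (plays (H (Suc r)) i) = Suc r"
  using less_length_plays[of r "Suc r" i] length_plays_le[of "Suc r" i] assms by simp

lemma pos_less:
  assumes "act r" "i \<in> S r" "k < r"
  shows "pos i k < pos i r"
proof -
  have "act k" "i \<in> S k" using assms act_mono S_antimono[of k r] by auto
  then have "pos i k \<le> length (H (Suc k))" using pos_bounds by blast
  also have "\<dots> \<le> length (H r)" using length_H_diff[of r "Suc k"] assms by simp
  finally show ?thesis using pos_bounds(1)[OF assms(1,2)] by simp
qed

end

text \<open>
  While \<open>j\<close> arms are left, the play made \<open>l\<close> rounds before the last one is more than \<open>l * j\<close> steps
  old, so it can be missing only if its delay exceeds \<open>l * j\<close>. Unlike the indicator of being
  missing, this bound does not depend on the history.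
\<close>

definition trunc_rew :: "nat \<Rightarrow> nat \<Rightarrow> nat \<Rightarrow> nat \<Rightarrow> real" where
  "trunc_rew D j l x = (if l * j < x then 1 else real x / real D)"

lemma lessThan_card_eq:
  fixes A :: "nat set"
  assumes "finite A" "\<And>k l. k \<in> A \<Longrightarrow> l < k \<Longrightarrow> l \<in> A"
  shows "A = {..<card A}"
proof (cases "A = {}")
  case False
  then have "A = {..Max A}"
  proof (intro equalityI subsetI)
    fix x assume "x \<in> {..Max A}"
    then show "x \<in> A" using assms(2)[of "Max A" x] Max_in[OF assms(1) False] by (cases "x = Max A") auto
  qed (use assms in simp)
  then show ?thesis by (metis card_atMost lessThan_Suc_atMost)
qed simp

section \<open>Empirical means as sums over round numbers\<close>

context rse_run begin

abbreviation X :: "nat \<Rightarrow> nat \<Rightarrow> nat" where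
  "X i k \<equiv> Y (pos i k, i)"

lemma length_plays_mono: "r \<le> r' \<Longrightarrow> length (plays (H r) i) \<le> length (plays (H r') i)"
  using less_length_plays[of "length (plays (H r') i)" r i] less_length_plays[of "length (plays (H r') i)" r' i]
  by (auto simp: not_le[symmetric] simp del: not_le)

context
  fixes r i assumes full: "length (plays (H r) i) = r"
begin

lemma full_act: "k < r \<Longrightarrow> act k \<and> i \<in> S k"
  using less_length_plays[of k r i] full by simp

lemma plays_full: "plays (H r) i = map (pos i) [0..<r]"
  using plays_H[of r i] full by simp

lemma inj_pos: "inj_on (pos i) {..<r}"
  using distinct_plays[of "H r" i] unfolding plays_full distinct_map by (simp add: atLeast0LessThan)

lemma play_set_eq: "{s \<in> {1..length (H r)}. arm_at (H r) s = i \<and> P s} = pos i ` {k \<in> {..<r}. P (pos i k)}"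
proof -
  have "{s \<in> {1..length (H r)}. arm_at (H r) s = i \<and> P s}
      = {s \<in> {s \<in> {1..length (H r)}. arm_at (H r) s = i}. P s}"
    by blast
  also have "{s \<in> {1..length (H r)}. arm_at (H r) s = i} = pos i ` {..<r}"
    using set_plays[of "H r" i] unfolding plays_full by (simp add: atLeast0LessThan)
  finally show ?thesis by auto
qed

lemma arm_at_pos: "k < r \<Longrightarrow> arm_at (H r) (pos i k) = i"
proof -
  assume "k < r"
  then have "pos i k \<in> set (plays (H r) i)" unfolding plays_full by simp
  then show ?thesis unfolding set_plays by simp
qed

lemma n_cnt_full: "n_cnt (H r) i = r"
proof -
  have "n_cnt (H r) i = card (pos i ` {..<r})"
    unfolding n_cnt_def using play_set_eq[of "\<lambda>_. True"] by (simp add: lessThan_def)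
  then show ?thesis using card_image[OF inj_pos] by simp
qed

text \<open>Play times increase with the round, so the sufficiently old plays are the earliest ones.
  Hence \<open>mu_F\<close> averages a prefix of the plays, the kind of sum that the concentration
  bounds control.\<close>

lemma F_set_eq: "F_set D (H r) i = pos i ` {..<card (F_set D (H r) i)}"
  and card_F_set: "card (F_set D (H r) i) \<le> r"
  and card_F_set_ge: "(\<And>k. k < q \<Longrightarrow> k < r \<and> pos i k + D \<le> length (H r) + 1) \<Longrightarrow> q \<le> card (F_set D (H r) i)"
proof -
  let ?A = "{k \<in> {..<r}. pos i k + D \<le> length (H r) + 1}"
  have F: "F_set D (H r) i = pos i ` ?A"
    unfolding F_set_def by (rule play_set_eq)
  have c: "card (F_set D (H r) i) = card ?A"
    unfolding F by (rule card_image) (rule inj_on_subset[OF inj_pos], auto)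
  have "?A = {..<card ?A}"
  proof (rule lessThan_card_eq)
    fix k l assume k: "k \<in> ?A" and "l < k"
    then have "pos i l < pos i k" using full_act[of k] by (intro pos_less) auto
    then show "l \<in> ?A" using k \<open>l < k\<close> by auto
  qed simp
  then show "F_set D (H r) i = pos i ` {..<card (F_set D (H r) i)}"
    using F c by metis
  show "card (F_set D (H r) i) \<le> r"
    unfolding c using card_mono[of "{..<r}" ?A] by auto
  show "q \<le> card (F_set D (H r) i)" if "\<And>k. k < q \<Longrightarrow> k < r \<and> pos i k + D \<le> length (H r) + 1"
  proof -
    have "{..<q} \<subseteq> ?A" using that by auto
    then show ?thesis unfolding c using card_mono[of ?A "{..<q}"] by auto
  qed
qed

lemma mu_F_eq:
  "mu_F D Y (H r) i = (\<Sum>k<card (F_set D (H r) i). real (X i k) / real D) / real (F_cnt D (H r) i)"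
proof -
  let ?m = "card (F_set D (H r) i)"
  have "(\<Sum>s\<in>F_set D (H r) i. rew_at D Y (H r) s) = (\<Sum>s\<in>pos i ` {..<?m}. rew_at D Y (H r) s)"
    using F_set_eq by simp
  also have "\<dots> = (\<Sum>k<?m. rew_at D Y (H r) (pos i k))"
    using card_F_set inj_pos by (subst sum.reindex) (auto intro: inj_on_subset)
  also have "\<dots> = (\<Sum>k<?m. real (X i k) / real D)"
    using card_F_set by (intro sum.cong) (auto simp: rew_at_def delay_at_def arm_at_pos)
  finally show ?thesis by (simp add: mu_F_def)
qed

text \<open>Missing plays count as 1 and observed ones as their reward, so both parts merge into one
  sum. The current time is \<open>length (H r) + 1\<close>, whence the strict inequality.\<close>

lemma mu_plus_eq:
  "mu_plus D Y (H r) i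
     = (\<Sum>k<r. if length (H r) < pos i k + X i k then 1 else real (X i k) / real D) / real r"
proof -
  let ?M = "{k \<in> {..<r}. length (H r) < pos i k + X i k}"
  have M: "M_set Y (H r) i = pos i ` ?M"
    unfolding M_set_def by (subst play_set_eq) (auto simp: delay_at_def arm_at_pos)
  have O: "O_set Y (H r) i = pos i ` {k \<in> {..<r}. \<not> length (H r) < pos i k + X i k}"
    (is "_ = pos i ` ?O")
    unfolding O_set_def by (subst play_set_eq) (auto simp: delay_at_def arm_at_pos)
  have "card (M_set Y (H r) i) = card ?M"
    unfolding M by (rule card_image) (rule inj_on_subset[OF inj_pos], auto)
  moreover have "(\<Sum>s\<in>O_set Y (H r) i. rew_at D Y (H r) s) = (\<Sum>k\<in>?O. rew_at D Y (H r) (pos i k))"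
    unfolding O by (subst sum.reindex) (auto intro: inj_on_subset[OF inj_pos])
  moreover have "\<dots> = (\<Sum>k\<in>?O. real (X i k) / real D)"
    by (intro sum.cong) (auto simp: rew_at_def delay_at_def arm_at_pos)
  moreover have "(\<Sum>k<r. if length (H r) < pos i k + X i k then 1 else real (X i k) / real D)
     = real (card ?M) + (\<Sum>k\<in>?O. real (X i k) / real D)"
    by (subst sum.If_cases) (auto intro!: arg_cong2[where f="(+)"] arg_cong[where f=card] sum.cong)
  ultimately show ?thesis unfolding mu_plus_def n_cnt_full by simp
qed

end

end

text \<open>The deterministic content of the good event. It covers every prefix length
  \<open>m\<close> and every \<open>j\<close>, since the numbers of fully observed plays and of
  remaining arms are random. The slack in \<open>dev_trunc\<close> bounds the expected number of
  \<open>l\<close> for which \<open>l * j\<close> is below the delay.\<close>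

locale rse_good = rse_run +
  fixes \<mu> :: "nat \<Rightarrow> real" and star :: nat
  assumes T: "T \<ge> 2" and D: "D \<ge> 1" and Y_le: "Y x \<le> D"
    and mu_bounds: "i \<in> {1..K} \<Longrightarrow> 0 \<le> \<mu> i \<and> \<mu> i \<le> 1"
    and star: "star \<in> {1..K}" "i \<in> {1..K} \<Longrightarrow> \<mu> i \<le> \<mu> star"
    and B: "B \<ge> \<mu> star / 2"
    and dev: "i \<in> {1..K} \<Longrightarrow> 1 \<le> m \<Longrightarrow> m \<le> length (plays (H T) i) \<Longrightarrow>
      \<bar>(\<Sum>k<m. real (X i k) / real D) - real m * \<mu> i\<bar> \<le> real m * sqrt (2 * ln (real T) / real m)"
    and dev_trunc: "i \<in> {1..K} \<Longrightarrow> 1 \<le> m \<Longrightarrow> m \<le> length (plays (H T) i) \<Longrightarrow> j \<in> {1..K} \<Longrightarrow>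
      (\<Sum>k<m. trunc_rew D j (m - Suc k) (X i k))
        \<le> real m * \<mu> i + 1 + real D * \<mu> i / real j + real m * sqrt (2 * ln (real T) / real m)"
begin

abbreviation "L \<equiv> ln (real T)"
abbreviation "rad m \<equiv> sqrt (2 * L / real m)"

text \<open>Makes the radius of a single sample at least 1, which keeps the bounds valid for an arm
  without fully observed plays.\<close>

lemma L_ge: "L \<ge> 1 / 2"
proof -
  have "ln 2 \<le> L" using T by simp
  then show ?thesis using ln2_ge_two_thirds by simp
qed

context
  fixes r i assumes full: "length (plays (H r) i) = r" and r: "1 \<le> r" "r \<le> T" and i: "i \<in> {1..K}"
begin

lemma mu_F_dev:
  assumes "card (F_set D (H r) i) \<ge> 1"
  shows "\<bar>mu_F D Y (H r) i - \<mu> i\<bar> \<le> rad (F_cnt D (H r) i)"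
proof -
  let ?m = "card (F_set D (H r) i)"
  have m: "?m \<le> length (plays (H T) i)"
    using card_F_set[OF full] length_plays_mono[OF r(2), of i] full by simp
  have F: "F_cnt D (H r) i = ?m" using assms by (simp add: F_cnt_def)
  have "mu_F D Y (H r) i - \<mu> i = ((\<Sum>k<?m. real (X i k) / real D) - real ?m * \<mu> i) / real ?m"
    unfolding mu_F_eq[OF full] F using assms by (simp add: diff_divide_distrib)
  then have "\<bar>mu_F D Y (H r) i - \<mu> i\<bar> = \<bar>(\<Sum>k<?m. real (X i k) / real D) - real ?m * \<mu> i\<bar> / real ?m"
    by simp
  also have "\<dots> \<le> (real ?m * rad ?m) / real ?m"
    by (intro divide_right_mono dev[OF i assms m]) simp
  finally show ?thesis using assms unfolding F by simp
qed

lemma LCB_le: "LCB T D Y (H r) i \<le> \<mu> i"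
proof (cases "card (F_set D (H r) i) \<ge> 1")
  case False
  then have "F_cnt D (H r) i = 1" "card (F_set D (H r) i) = 0" by (auto simp: F_cnt_def)
  moreover have "0 \<le> sqrt (2 * L)" using L_ge by simp
  then have "- sqrt (2 * L) \<le> \<mu> i" using mu_bounds[OF i] by linarith
  ultimately show ?thesis
    by (simp add: LCB_def mu_F_eq[OF full])
qed (use mu_F_dev in \<open>auto simp: LCB_def abs_if split: if_splits\<close>)

lemma U2_ge: "\<mu> i \<le> U2 T D Y (H r) i"
proof (cases "card (F_set D (H r) i) \<ge> 1")
  \<comment> \<open>Without an old play the mean defaults to 0 and the count to 1, so the bound is
    the radius \<open>sqrt (2 * L)\<close> alone.\<close>
  case False
  then have "F_cnt D (H r) i = 1" "card (F_set D (H r) i) = 0" by (auto simp: F_cnt_def)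
  moreover have "1 \<le> sqrt (2 * L)" using L_ge by simp
  then have "\<mu> i \<le> sqrt (2 * L)" using mu_bounds[OF i] by linarith
  ultimately show ?thesis
    by (simp add: U2_def mu_F_eq[OF full])
qed (use mu_F_dev in \<open>auto simp: U2_def abs_if split: if_splits\<close>)

text \<open>Rewards are at most 1, so counting a missing play as 1 can only raise the mean.\<close>

lemma U1_ge: "\<mu> i \<le> U1 T D Y (H r) i"
proof -
  have "real r * \<mu> i - real r * rad r \<le> (\<Sum>k<r. real (X i k) / real D)"
    using dev[OF i r(1)] length_plays_mono[OF r(2), of i] full by (auto simp: abs_if split: if_splits)
  also have "\<dots> \<le> (\<Sum>k<r. if length (H r) < pos i k + X i k then 1 else real (X i k) / real D)"
    using Y_le D by (intro sum_mono) (auto simp: divide_le_eq)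
  finally have "(real r * \<mu> i - real r * rad r) / real r \<le> mu_plus D Y (H r) i"
    unfolding mu_plus_eq[OF full] by (rule divide_right_mono) simp
  then show ?thesis using r by (simp add: U1_def n_cnt_full[OF full] diff_divide_distrib)
qed

lemma UCB_ge: "\<mu> i \<le> UCB T D Y (H r) i"
  using U1_ge U2_ge by (simp add: UCB_def)

end

lemma S_imp_arm: "i \<in> S r \<Longrightarrow> i \<in> {1..K}"
  using S_subset by blast

text \<open>With valid bounds, no lower bound of an arm exceeds the upper bound of the best arm.
  Only the threshold can remove it, and then \<open>B\<close> exceeds a valid upper bound of
  \<open>\<mu> star\<close>.\<close>

lemma star_eliminated: "star \<notin> S r \<Longrightarrow> \<mu> star \<le> B"
proof (induction r)
  case (Suc r)
  show ?case
  proof (cases "star \<in> S r \<and> act r")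
    case True
    then obtain j where j: "j \<in> S r" "max (LCB T D Y (H (Suc r)) j) B > UCB T D Y (H (Suc r)) star"
      using Suc.prems by (auto simp: S_Suc split: if_splits)
    have T: "Suc r \<le> T" using True act_less[of r] by simp
    have "LCB T D Y (H (Suc r)) j \<le> \<mu> j"
      using True j T by (intro LCB_le length_plays_H S_imp_arm) auto
    also have "\<dots> \<le> \<mu> star" using star j S_imp_arm by blast
    also have "\<mu> star \<le> UCB T D Y (H (Suc r)) star"
      using True T star by (intro UCB_ge length_plays_H) auto
    finally have "LCB T D Y (H (Suc r)) j \<le> UCB T D Y (H (Suc r)) star" .
    then show ?thesis using j(2) \<open>\<mu> star \<le> UCB _ _ _ _ _\<close> by linarith
  qed (use Suc in \<open>auto simp: S_Suc split: if_splits\<close>)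
qed (use star in simp)

end

section \<open>Elimination time and pathwise regret\<close>

text \<open>The cardinality is the rank of \<open>i\<close> by decreasing \<open>N\<close>, ties
  receiving the larger rank. Distinct ranks would give exactly the harmonic number.\<close>

lemma sum_inverse_rank_le_harm:
  fixes N :: "'a \<Rightarrow> nat"
  assumes "finite A"
  shows "(\<Sum>i\<in>A. 1 / real (card {j \<in> A. N i \<le> N j})) \<le> harm (card A)"
  using assms
\<comment> \<open>The negation makes the inserted element one with smallest \<open>N\<close>: its
  rank is the size of the whole set, and inserting it lowers no other rank.\<close>
proof (induction A rule: finite_ranking_induct[where f = "\<lambda>i. - int (N i)"])
  case empty
  then show ?case by (simp add: harm_def)
next
  case (insert x A)
  show ?case
  proof (cases "x \<in> A")
    case False
    have x: "{j \<in> insert x A. N x \<le> N j} = insert x A" using insert by auto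
    have "(\<Sum>i\<in>A. 1 / real (card {j \<in> insert x A. N i \<le> N j})) \<le> (\<Sum>i\<in>A. 1 / real (card {j \<in> A. N i \<le> N j}))"
    proof (intro sum_mono divide_left_mono mult_pos_pos)
      fix i assume i: "i \<in> A"
      then have p: "card {j \<in> A. N i \<le> N j} > 0" using insert by (auto simp: card_gt_0_iff)
      have le: "card {j \<in> A. N i \<le> N j} \<le> card {j \<in> insert x A. N i \<le> N j}"
        using insert by (intro card_mono) auto
      show "real (card {j \<in> A. N i \<le> N j}) \<le> real (card {j \<in> insert x A. N i \<le> N j})"
        "0 < real (card {j \<in> A. N i \<le> N j})" "0 < real (card {j \<in> insert x A. N i \<le> N j})"
        using p le by auto
    qed simp
    then show ?thesis
      using insert.IH insert.hyps(1) False x by (simp add: harm_Suc inverse_eq_divide)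
  qed (use insert in \<open>simp add: insert_absorb\<close>)
qed

text \<open>Each increment \<open>1 / x\<close> is at most \<open>2 * ln (1 + 1 / x)\<close>,
  because this logarithm is at least \<open>1 / (x + 1)\<close> and \<open>x + 1\<close> is at most
  \<open>2 * x\<close>. The case \<open>n = K - 2\<close> bounds
  \<open>harm (K - 1)\<close>.\<close>

lemma harm_le_2_ln:
  "harm (Suc n) \<le> 2 * ln (real (Suc (Suc n)))"
proof (induction n)
  case 0
  show ?case using ln2_ge_two_thirds by (simp add: harm_def)
next
  case (Suc n)
  define x where "x = real (Suc (Suc n))"
  have x: "x \<ge> 2" by (simp add: x_def)
  have "1 - 1 / (1 + 1 / x) \<le> ln (1 + 1 / x)"
  proof -
    have "1 + 1 / x > 0" using x by (simp add: add_pos_pos)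
    then show ?thesis using ln_le_minus_one[of "1 / (1 + 1 / x)"] by (simp add: ln_div)
  qed
  moreover have "1 - 1 / (1 + 1 / x) = 1 / (x + 1)" using x by (simp add: field_simps)
  moreover have "1 / x \<le> 2 * (1 / (x + 1))" using x by (simp add: field_simps)
  moreover have "ln (1 + 1 / x) = ln (x + 1) - ln x"
  proof -
    have "1 + 1 / x = (x + 1) / x" using x by (simp add: field_simps)
    then show ?thesis using x by (simp add: ln_div)
  qed
  ultimately have "1 / x \<le> 2 * ln (x + 1) - 2 * ln x" by linarith
  then show ?case using Suc unfolding harm_Suc[of "Suc n"] x_def
    by (simp add: inverse_eq_divide algebra_simps)
qed

context rse_good begin

section \<open>How many rounds an arm can survive\<close>

context
  fixes q i
  assumes act: "act (Suc q)" and i: "i \<in> S (Suc q)"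
begin

lemma prev: "act q" "i \<in> S q" "Suc q \<le> T"
  using act act_Suc[of q] S_antimono[of q "Suc q"] i act_less[of q] by auto

text \<open>The test that ends round \<open>q\<close> compares \<open>i\<close> with all of
  \<open>S q\<close>, including arms removed by this same test.\<close>

lemma survives:
  "B \<le> UCB T D Y (H (Suc q)) i" "j \<in> S q \<Longrightarrow> LCB T D Y (H (Suc q)) j \<le> UCB T D Y (H (Suc q)) i"
  using i prev by (force simp: S_Suc not_less)+

text \<open>Every round so far took at least \<open>card (S (Suc q))\<close> steps, so
  \<open>D div card (S (Suc q)) + 1\<close> rounds last longer than \<open>D\<close>. Only that many
  of the latest plays can be too young.\<close>

lemma card_F_set_lower:
  assumes "a \<in> S q"
  shows "Suc q - (D div card (S (Suc q)) + 1) \<le> card (F_set D (H (Suc q)) a)"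
proof (rule card_F_set_ge)
  show full: "length (plays (H (Suc q)) a) = Suc q"
    by (rule length_plays_H) (use prev assms in auto)
  let ?j = "card (S (Suc q))"
  fix k assume k: "k < Suc q - (D div ?j + 1)"
  have j: "?j \<ge> 1" using card_S_pos[OF act] .
  have "D < (D div ?j + 1) * ?j"
    using j dividend_less_times_div[of ?j D] by (simp add: algebra_simps)
  also have "\<dots> \<le> (Suc q - Suc k) * ?j" using k by (intro mult_right_mono) auto
  finally have "D < (Suc q - Suc k) * ?j" .
  moreover have "length (H (Suc k)) + (Suc q - Suc k) * ?j \<le> length (H (Suc q))"
    by (rule length_H_diff[OF act]) (use k in auto)
  moreover have "pos a k \<le> length (H (Suc k))"
    using full_act[OF full, of k] k by (intro pos_bounds) auto
  ultimately show "k < Suc q \<and> pos a k + D \<le> length (H (Suc q)) + 1" using k by auto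
qed

lemma rounds_le_F:
  assumes gap: "\<mu> i < \<mu> star"
  shows "real (Suc q) \<le> 32 * L / (\<mu> star - \<mu> i)\<^sup>2 + real D / real (card (S (Suc q))) + 1"
proof -
  let ?j = "card (S (Suc q))"
  define c where "c = D div ?j + 1"
  define \<Delta> where "\<Delta> = \<mu> star - \<mu> i"
  have c: "real c \<le> real D / real ?j + 1"
    unfolding c_def using of_nat_div_le_of_nat[of D ?j] by simp
  have \<Delta>: "\<Delta> > 0" using gap by (simp add: \<Delta>_def)
  have nonneg: "32 * L / \<Delta>\<^sup>2 \<ge> 0" using L_ge by simp
  show ?thesis
  proof (cases "Suc q \<le> c")
    case True
    then show ?thesis using c nonneg unfolding \<Delta>_def by linarith
  next
    case False
    define n where "n = Suc q - c"
    have n: "n \<ge> 1" using False by (simp add: n_def)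
    have F: "n \<le> card (F_set D (H (Suc q)) a)" if "a \<in> S q" for a
      using card_F_set_lower[OF that] by (simp add: n_def c_def)
    have dev: "\<bar>mu_F D Y (H (Suc q)) a - \<mu> a\<bar> \<le> rad n" "rad (F_cnt D (H (Suc q)) a) \<le> rad n"
      if a: "a \<in> S q" for a
    proof -
      have "real n \<le> real (F_cnt D (H (Suc q)) a)" using F[OF a] by (simp add: F_cnt_def)
      then show r: "rad (F_cnt D (H (Suc q)) a) \<le> rad n"
        using n L_ge by (intro real_sqrt_le_mono divide_left_mono mult_pos_pos) auto
      have "\<bar>mu_F D Y (H (Suc q)) a - \<mu> a\<bar> \<le> rad (F_cnt D (H (Suc q)) a)"
        using prev a n F[OF a] by (intro mu_F_dev length_plays_H S_imp_arm[OF a]) auto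
      then show "\<bar>mu_F D Y (H (Suc q)) a - \<mu> a\<bar> \<le> rad n" using r by (rule order_trans)
    qed
    have up: "UCB T D Y (H (Suc q)) i \<le> \<mu> i + 2 * rad n"
    proof -
      have "UCB T D Y (H (Suc q)) i \<le> U2 T D Y (H (Suc q)) i" by (simp add: UCB_def)
      then show ?thesis using dev[OF prev(2)] unfolding U2_def by linarith
    qed
    \<comment> \<open>Two radii, deviation plus width, separate \<open>UCB\<close> from
      \<open>\<mu> i\<close>, and two more separate \<open>LCB\<close> from
      \<open>\<mu> star\<close>. Presence of \<open>star\<close> in \<open>S q\<close> suffices, as
      its lower bound enters the test even if it is removed then. Squaring gives
      \<open>16 * 2 = 32\<close>.\<close>
    have "\<Delta> \<le> 4 * rad n"
    proof (cases "star \<in> S q")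
      case True
      have "\<mu> star - 2 * rad n \<le> LCB T D Y (H (Suc q)) star"
        using dev[OF True] unfolding LCB_def by linarith
      then show ?thesis using survives(2)[OF True] up by (simp add: \<Delta>_def)
    next
      case False
      have "0 \<le> rad n" using L_ge by simp
      then show ?thesis using star_eliminated[OF False] survives(1) up unfolding \<Delta>_def by linarith
    qed
    then have "\<Delta>\<^sup>2 \<le> (4 * rad n)\<^sup>2" using \<Delta> by (intro power_mono) auto
    also have "\<dots> = 32 * L / real n" using L_ge by (simp add: power_mult_distrib)
    finally have "real n \<le> 32 * L / \<Delta>\<^sup>2" using n \<Delta> by (simp add: field_simps)
    moreover have "real (Suc q) = real n + real c" using False by (simp add: n_def)
    ultimately show ?thesis using c unfolding \<Delta>_def by linarith
  qed
qed

lemma rounds_le_threshold: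
  assumes small: "\<mu> i < \<mu> star / 6"
  shows "real (Suc q) * \<mu> star
    \<le> 6 + 6 * (real D * \<mu> i / real (card (S (Suc q)))) + 72 * L / \<mu> star"
proof -
  let ?j = "card (S (Suc q))" and ?r = "Suc q"
  have full: "length (plays (H ?r) i) = ?r"
    by (rule length_plays_H) (use prev in auto)
  have iK: "i \<in> {1..K}" using S_imp_arm[OF i] .
  have j: "?j \<in> {1..K}" using card_S_pos[OF act] card_S by simp
  have m: "?r \<le> length (plays (H T) i)" using full length_plays_mono[OF prev(3), of i] by simp
  have mu: "\<mu> star > 0" using small mu_bounds[OF iK] by linarith
  have "(\<Sum>k<?r. if length (H ?r) < pos i k + X i k then 1 else real (X i k) / real D)
      \<le> (\<Sum>k<?r. trunc_rew D ?j (?r - Suc k) (X i k))"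
  proof (rule sum_mono)
    fix k assume k: "k \<in> {..<?r}"
    have "length (H (Suc k)) + (?r - Suc k) * ?j \<le> length (H ?r)"
      by (rule length_H_diff[OF act]) (use k in auto)
    moreover have "pos i k \<le> length (H (Suc k))"
      using full_act[OF full, of k] k by (intro pos_bounds) auto
    moreover have "real (X i k) / real D \<le> 1" using Y_le D by (auto simp: divide_le_eq)
    ultimately show "(if length (H ?r) < pos i k + X i k then 1 else real (X i k) / real D)
      \<le> trunc_rew D ?j (?r - Suc k) (X i k)" by (auto simp: trunc_rew_def)
  qed
  also have "\<dots> \<le> real ?r * \<mu> i + 1 + real D * \<mu> i / real ?j + real ?r * rad ?r"
    by (rule dev_trunc[OF iK _ m j]) simp
  finally have "mu_plus D Y (H ?r) i \<le> (real ?r * \<mu> i + 1 + real D * \<mu> i / real ?j + real ?r * rad ?r) / real ?r"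
    unfolding mu_plus_eq[OF full] by (rule divide_right_mono) simp
  also have "\<dots> = \<mu> i + (1 + real D * \<mu> i / real ?j) / real ?r + rad ?r"
    by (simp add: add_divide_distrib del: of_nat_Suc)
  finally have "U1 T D Y (H ?r) i \<le> \<mu> i + (1 + real D * \<mu> i / real ?j) / real ?r + 2 * rad ?r"
    by (simp add: U1_def n_cnt_full[OF full])
  moreover have "\<mu> star / 2 \<le> U1 T D Y (H ?r) i" using survives(1) B by (simp add: UCB_def)
  moreover define z where "z = (1 + real D * \<mu> i / real ?j) / real ?r"
  \<comment> \<open>Subtracting \<open>\<mu> i\<close>, which is below
    \<open>\<mu> star / 6\<close>, from \<open>\<mu> star / 2\<close> leaves at least
    \<open>\<mu> star / 3\<close> for the missing plays and two radii.\<close>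
  ultimately have *: "\<mu> star / 3 \<le> z + 2 * rad ?r"
    using small by linarith
  define e where "e = L / real ?r"
  have e: "(rad ?r)\<^sup>2 = 2 * e" using L_ge by (simp add: e_def)
  \<comment> \<open>AM-GM with weight \<open>\<mu> star / 6\<close>\<close>
  have "0 \<le> (rad ?r - \<mu> star / 6)\<^sup>2" by simp
  also have "\<dots> = 2 * e - 2 * rad ?r * (\<mu> star / 6) + (\<mu> star / 6)\<^sup>2"
    unfolding power2_diff e by simp
  finally have "2 * (rad ?r * \<mu> star) \<le> 12 * e + \<mu> star * \<mu> star / 6"
    by (simp add: power2_eq_square algebra_simps del: of_nat_Suc)
  moreover have "\<mu> star * (\<mu> star / 3) \<le> \<mu> star * (z + 2 * rad ?r)"
    using mu * by (intro mult_left_mono) auto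
  \<comment> \<open>Half of the square term is absorbed and one sixth remains; multiplying by 6
    yields the constants 6 and \<open>6 * 12 = 72\<close>.\<close>
  ultimately have "\<mu> star * \<mu> star \<le> 6 * (\<mu> star * z) + 72 * e"
    by (simp add: algebra_simps del: of_nat_Suc)
  \<comment> \<open>The factor \<open>?r\<close> cancels the denominators of \<open>z\<close> and
    \<open>e\<close>.\<close>
  then have "real ?r * (\<mu> star * \<mu> star) \<le> real ?r * (6 * (\<mu> star * z) + 72 * e)"
    by (rule mult_left_mono) simp
  also have "\<dots> = 6 * \<mu> star * (real ?r * z) + 72 * (real ?r * e)"
    by (simp add: distrib_left del: of_nat_Suc)
  also have "real ?r * z = 1 + real D * \<mu> i / real ?j" by (simp add: z_def del: of_nat_Suc)
  also have "real ?r * e = L" by (simp add: e_def del: of_nat_Suc)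
  finally have "(real ?r * \<mu> star * \<mu> star) / \<mu> star \<le> (6 * \<mu> star * (1 + real D * \<mu> i / real ?j) + 72 * L) / \<mu> star"
    using mu by (intro divide_right_mono) (auto simp: mult.assoc)
  moreover have "(real ?r * \<mu> star * \<mu> star) / \<mu> star = real ?r * \<mu> star" using mu by simp
  ultimately have "real ?r * \<mu> star \<le> (6 * \<mu> star * (1 + real D * \<mu> i / real ?j) + 72 * L) / \<mu> star"
    by simp
  then show ?thesis using mu by (simp add: add_divide_distrib distrib_left del: of_nat_Suc)
qed

end

section \<open>Regret of one arm and of a whole run\<close>

abbreviation "N i \<equiv> length (plays (H T) i)"

lemma N_pos: "i \<in> {1..K} \<Longrightarrow> N i \<ge> 1"
  using less_length_plays[of 0 T i] T by (simp add: act_def Suc_le_eq)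

lemma last_round:
  assumes "i \<in> {1..K}"
  shows "act (N i - 1)" "i \<in> S (N i - 1)"
  using less_length_plays[of "N i - 1" T i] N_pos[OF assms] by auto

text \<open>Arm \<open>i\<close> passes \<open>N i - 1\<close> tests, to which the bounds on rounds
  apply, and its last play costs at most 1 more. The constant 7 is this 1 plus the 6 of
  \<open>rounds_le_threshold\<close>.\<close>

lemma arm_regret:
  assumes iK: "i \<in> {1..K}" and gap: "\<mu> i < \<mu> star"
  shows "real (N i) * (\<mu> star - \<mu> i) \<le> 72 * L / (\<mu> star - \<mu> i) + 7
    + 6 * min (real D * \<mu> i) (real D * (\<mu> star - \<mu> i)) / real (card (S (N i - 1)))"
proof -
  define \<Delta> where "\<Delta> = \<mu> star - \<mu> i"
  define j where "j = real (card (S (N i - 1)))"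
  define Mi where "Mi = min (real D * \<mu> i) (real D * \<Delta>)"
  have \<Delta>: "0 < \<Delta>" "\<Delta> \<le> 1" "\<Delta> \<le> \<mu> star" using gap mu_bounds[OF iK] mu_bounds[OF star(1)] by (auto simp: \<Delta>_def)
  have j: "j \<ge> 1" using card_S_pos[OF last_round(1)[OF iK]] by (simp add: j_def)
  have Mi: "Mi \<ge> 0" using mu_bounds[OF iK] \<Delta> by (simp add: Mi_def)
  have LD: "L / \<Delta> \<ge> 0" using L_ge \<Delta> by simp
  have MiD: "Mi / j \<ge> 0" using Mi j by simp
  have "real (N i) * \<Delta> \<le> 72 * L / \<Delta> + 7 + 6 * Mi / j"
  proof (cases "N i = 1")
    case True
    then show ?thesis using \<Delta> LD MiD by simp
  next
    case False
    then obtain q where q: "N i - 1 = Suc q" using N_pos[OF iK] by (cases "N i - 1") auto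
    have r: "real (N i) * \<Delta> = real (Suc q) * \<Delta> + \<Delta>"
    proof -
      have "N i = Suc (Suc q)" using q by simp
      then show ?thesis by (simp add: algebra_simps)
    qed
    note last = last_round[OF iK, unfolded q]
    have "real (Suc q) * \<Delta> \<le> (32 * L / \<Delta>\<^sup>2 + real D / j + 1) * \<Delta>"
      using rounds_le_F[OF last gap] \<Delta> unfolding j_def q \<Delta>_def by (intro mult_right_mono) auto
    also have "\<dots> = 32 * L / \<Delta> + real D * \<Delta> / j + \<Delta>"
      using \<Delta> by (simp add: distrib_right power2_eq_square)
    finally have b1: "real (Suc q) * \<Delta> \<le> 32 * (L / \<Delta>) + real D * \<Delta> / j + \<Delta>" by simp
    show ?thesis
    proof (cases "\<mu> i < \<mu> star / 6")
      case False
      then have "\<Delta> \<le> 5 * \<mu> i" by (simp add: \<Delta>_def)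
      then have "real D * \<Delta> \<le> real D * (5 * \<mu> i)" by (rule mult_left_mono) simp
      then have "real D * \<Delta> \<le> 6 * Mi" using \<Delta> mu_bounds[OF iK] by (auto simp: Mi_def min_def)
      then have "real D * \<Delta> / j \<le> 6 * Mi / j" using j by (intro divide_right_mono) auto
      then show ?thesis using b1 r \<Delta> LD by simp
    next
      case True
      have "real (Suc q) * \<Delta> \<le> real (Suc q) * \<mu> star" using \<Delta> by (intro mult_left_mono) auto
      also have "\<dots> \<le> 6 + 6 * (real D * \<mu> i / j) + 72 * L / \<mu> star"
        using rounds_le_threshold[OF last True] unfolding j_def q .
      also have "72 * L / \<mu> star \<le> 72 * L / \<Delta>" using \<Delta> L_ge by (intro divide_left_mono) auto
      finally have b2: "real (Suc q) * \<Delta> \<le> 6 + 6 * (real D * \<mu> i / j) + 72 * (L / \<Delta>)" by simp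
      show ?thesis
      \<comment> \<open>Both bounds on the rounds are available here; the one whose delay term
        attains the minimum is used.\<close>
      proof (cases "real D * \<mu> i \<le> real D * \<Delta>")
        case True
        then show ?thesis using b2 r \<Delta> by (simp add: Mi_def)
      next
        case False
        then have v: "real D * \<Delta> / j = Mi / j" by (simp add: Mi_def)
        have "real (N i) * \<Delta> \<le> 72 * (L / \<Delta>) + 7 + 6 * (Mi / j)"
          using b1 r \<Delta> LD MiD unfolding v by linarith
        then show ?thesis by simp
      qed
    qed
  qed
  then show ?thesis unfolding \<Delta>_def j_def Mi_def .
qed

text \<open>An arm played at least as often as \<open>i\<close> is still present in the last round
  of \<open>i\<close>, so \<open>card (S (N i - 1))\<close> is at least the rank of \<open>i\<close>
  among the suboptimal arms. The best arm is not ranked, whence \<open>harm (K - 1)\<close>.\<close>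

lemma regret_bound:
  defines "A \<equiv> {i \<in> {1..K}. \<mu> i < \<mu> star}"
  assumes K2: "K \<ge> 2"
    and M: "M \<ge> 0" "\<And>i. i \<in> A \<Longrightarrow> min (real D * \<mu> i) (real D * (\<mu> star - \<mu> i)) \<le> M"
  shows "(\<Sum>i\<in>A. real (N i) * (\<mu> star - \<mu> i))
    \<le> (\<Sum>i\<in>A. 72 * L / (\<mu> star - \<mu> i) + 7) + 12 * M * ln (real K)"
proof -
  have A: "finite A" "A \<subseteq> {1..K} - {star}" by (auto simp: A_def)
  have "real (N i) * (\<mu> star - \<mu> i)
      \<le> 72 * L / (\<mu> star - \<mu> i) + 7 + 6 * M * (1 / real (card {j \<in> A. N i \<le> N j}))" if i: "i \<in> A" for i
  proof -
    have iK: "i \<in> {1..K}" "\<mu> i < \<mu> star" using i by (auto simp: A_def)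
    have "{j \<in> A. N i \<le> N j} \<subseteq> S (N i - 1)"
    proof
      fix j assume j: "j \<in> {j \<in> A. N i \<le> N j}"
      then have "j \<in> S (N j - 1)" by (intro last_round) (auto simp: A_def)
      moreover have "N i - 1 \<le> N j - 1" using j by auto
      ultimately show "j \<in> S (N i - 1)" using S_antimono by blast
    qed
    then have "card {j \<in> A. N i \<le> N j} \<le> card (S (N i - 1))" by (intro card_mono) auto
    moreover have "0 < card {j \<in> A. N i \<le> N j}" using i A by (auto simp: card_gt_0_iff)
    ultimately have "6 * min (real D * \<mu> i) (real D * (\<mu> star - \<mu> i)) / real (card (S (N i - 1)))
      \<le> 6 * M / real (card {j \<in> A. N i \<le> N j})"
      using M(1) M(2)[OF i] by (intro frac_le) auto
    then show ?thesis using arm_regret[OF iK] by simp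
  qed
  then have le: "(\<Sum>i\<in>A. real (N i) * (\<mu> star - \<mu> i))
      \<le> (\<Sum>i\<in>A. 72 * L / (\<mu> star - \<mu> i) + 7) + 6 * M * (\<Sum>i\<in>A. 1 / real (card {j \<in> A. N i \<le> N j}))"
    unfolding sum_distrib_left sum.distrib[symmetric] by (rule sum_mono)
  moreover have "(\<Sum>i\<in>A. 1 / real (card {j \<in> A. N i \<le> N j})) \<le> harm (card A)"
    by (rule sum_inverse_rank_le_harm) (rule A)
  moreover have "harm (card A) \<le> (harm (K - 1) :: real)"
    using card_mono[OF _ A(2)] star by (intro harm_mono) simp
  moreover have "harm (K - 1) \<le> 2 * ln (real K)"
  proof -
    have "K - 1 = Suc (K - 2)" "K = Suc (Suc (K - 2))" using K2 by auto
    then show ?thesis using harm_le_2_ln[of "K - 2"] by metis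
  qed
  ultimately have "6 * M * (\<Sum>i\<in>A. 1 / real (card {j \<in> A. N i \<le> N j})) \<le> 6 * M * (2 * ln (real K))"
    using M(1) by (intro mult_left_mono) linarith+
  then show ?thesis using le by simp
qed

end

section \<open>Probability of the bad event and expected regret\<close>

text \<open>At this radius the Hoeffding exponent is \<open>4 * ln (real T)\<close> for every
  \<open>m\<close>. The fourth power pays for the union over arms, play counts and numbers of
  remaining arms, and for linear regret on the bad event.\<close>

lemma adaptive_hoeffding_radius:
  fixes f :: "nat \<Rightarrow> nat \<Rightarrow> real"
  assumes A: "finite A" and h: "nonanticipating h" and len: "\<And>Y. length (h Y) \<le> L"
    and i: "\<And>s. s \<in> {1..L} \<Longrightarrow> (s, i) \<in> A"
    and p: "\<And>s. s \<in> {1..L} \<Longrightarrow> p (s, i) = q"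
    and f: "\<And>k x. x \<in> set_pmf q \<Longrightarrow> f k x \<in> {0..1}"
    and m: "m \<ge> 1" and T: "T \<ge> 2"
  shows "measure_pmf.prob (Pi_pmf A d p)
     {Y. m \<le> length (plays (h Y) i) \<and>
         (\<Sum>k<m. f k (Y (plays (h Y) i ! k, i))) \<ge>
           measure_pmf.expectation q (\<lambda>x. \<Sum>k<m. f k x) + real m * sqrt (2 * ln (real T) / real m)}
     \<le> 1 / real T ^ 4"
proof -
  have L: "ln (real T) > 0" using T by simp
  have "exp (- 2 * real m * (sqrt (2 * ln (real T) / real m))\<^sup>2) = exp (- (4 * ln (real T)))"
    using m L by simp
  also have "\<dots> = 1 / real T ^ 4"
  proof -
    have "exp (4 * ln (real T)) = real T ^ 4"
      using T exp_of_nat_mult[of 4 "ln (real T)"] by simp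
    then show ?thesis by (simp add: exp_minus inverse_eq_divide)
  qed
  finally show ?thesis
    using adaptive_hoeffding[where A = A and h = h and p = p and q = q and f = f and i = i and L = L and n = m and d = d
      and \<epsilon> = "sqrt (2 * ln (real T) / real m)", OF A h len i p f] m L
    by simp
qed

text \<open>Truncation raises a term by at most 1, and only when \<open>l * j < x\<close>, which
  holds for at most \<open>x div j + 1\<close> values of \<open>l\<close>.\<close>

lemma sum_trunc_rew_le:
  assumes "j \<ge> 1"
  shows "(\<Sum>k<m. trunc_rew D j (m - Suc k) x) \<le> real m * (real x / real D) + 1 + real x / real j"
proof -
  have "(\<Sum>k<m. trunc_rew D j (m - Suc k) x) = (\<Sum>l<m. trunc_rew D j l x)"
    by (rule sum.nat_diff_reindex)
  also have "\<dots> \<le> (\<Sum>l<m. real x / real D + of_bool (l * j < x))"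
    by (intro sum_mono) (auto simp: trunc_rew_def)
  also have "\<dots> = real m * (real x / real D) + real (card {l \<in> {..<m}. l * j < x})"
    by (simp add: sum.distrib of_bool_def sum.If_cases Int_def)
  also have "card {l \<in> {..<m}. l * j < x} \<le> card {..x div j}"
    using assms by (intro card_mono) (auto simp: less_eq_div_iff_mult_less_eq)
  also have "real (card {..x div j}) \<le> 1 + real x / real j"
    using of_nat_div_le_of_nat[of x j] by simp
  finally show ?thesis by simp
qed

text \<open>Equality counts as failure, matching the Hoeffding bound. The third part ranges over all
  \<open>j\<close>, which makes \<open>K + 2\<close> tail events for each \<open>i\<close> and
  \<open>m\<close>.\<close>

definition bad_event :: "nat \<Rightarrow> nat \<Rightarrow> nat \<Rightarrow> (nat \<Rightarrow> nat pmf) \<Rightarrow> ((nat \<times> nat \<Rightarrow> nat) \<Rightarrow> nat list)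
    \<Rightarrow> nat \<Rightarrow> nat \<Rightarrow> (nat \<times> nat \<Rightarrow> nat) set" where
  "bad_event T K D Dist h i m = (let rad = real m * sqrt (2 * ln (real T) / real m) in
     {Y. m \<le> length (plays (h Y) i) \<and>
       (\<Sum>k<m. real (Y (plays (h Y) i ! k, i)) / real D) \<ge> real m * mean_rew D Dist i + rad} \<union>
     {Y. m \<le> length (plays (h Y) i) \<and>
       (\<Sum>k<m. real (Y (plays (h Y) i ! k, i)) / real D) \<le> real m * mean_rew D Dist i - rad} \<union>
     (\<Union>j\<in>{1..K}. {Y. m \<le> length (plays (h Y) i) \<and>
       (\<Sum>k<m. trunc_rew D j (m - Suc k) (Y (plays (h Y) i ! k, i)))
         \<ge> real m * mean_rew D Dist i + 1 + real D * mean_rew D Dist i / real j + rad}))"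

lemma prob_bad_event:
  assumes A: "finite A" and h: "nonanticipating h" and len: "\<And>Y. length (h Y) \<le> L"
    and i: "\<And>s. s \<in> {1..L} \<Longrightarrow> (s, i) \<in> A"
    and p: "\<And>s. s \<in> {1..L} \<Longrightarrow> p (s, i) = Dist i"
    and D: "D \<ge> 1" "set_pmf (Dist i) \<subseteq> {0..D}"
    and m: "m \<ge> 1" and T: "T \<ge> 2"
  shows "measure_pmf.prob (Pi_pmf A d p) (bad_event T K D Dist h i m) \<le> real (K + 2) / real T ^ 4"
proof -
  let ?M = "Pi_pmf A d p"
  let ?rad = "real m * sqrt (2 * ln (real T) / real m)"
  let ?\<mu> = "mean_rew D Dist i"
  let ?E = "\<lambda>f. measure_pmf.expectation (Dist i) f"
  let ?x = "\<lambda>Y k. Y (plays (h Y) i ! k, i)"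
  have fin: "finite (set_pmf (Dist i))" using D finite_subset by blast
  note int = integrable_measure_pmf_finite[OF fin]
  have le1: "real x / real D \<in> {0..1}" if "x \<in> set_pmf (Dist i)" for x
    using D that by (auto simp: divide_le_eq)
  have hoeff: "measure_pmf.prob ?M {Y. m \<le> length (plays (h Y) i) \<and>
         (\<Sum>k<m. f k (?x Y k)) \<ge> ?E (\<lambda>x. \<Sum>k<m. f k x) + ?rad} \<le> 1 / real T ^ 4"
    if "\<And>k x. x \<in> set_pmf (Dist i) \<Longrightarrow> f k x \<in> {0..1}" for f :: "nat \<Rightarrow> nat \<Rightarrow> real"
    by (rule adaptive_hoeffding_radius[where L = L]) (use A h len i p m T that in auto)
  define E1 where "E1 = {Y. m \<le> length (plays (h Y) i) \<and>
       (\<Sum>k<m. real (?x Y k) / real D) \<ge> real m * ?\<mu> + ?rad}"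
  define E2 where "E2 = {Y. m \<le> length (plays (h Y) i) \<and>
       (\<Sum>k<m. real (?x Y k) / real D) \<le> real m * ?\<mu> - ?rad}"
  define E3 where "E3 j = {Y. m \<le> length (plays (h Y) i) \<and>
       (\<Sum>k<m. trunc_rew D j (m - Suc k) (?x Y k))
         \<ge> real m * ?\<mu> + 1 + real D * ?\<mu> / real j + ?rad}" for j
  have "?E (\<lambda>x. \<Sum>k<m. real x / real D) = real m * ?\<mu>"
    by (simp add: mean_rew_def)
  then have E1: "measure_pmf.prob ?M E1 \<le> 1 / real T ^ 4"
    using hoeff[of "\<lambda>_ x. real x / real D"] le1 unfolding E1_def by simp
  \<comment> \<open>The lower tail is the upper tail of the complementary reward
    \<open>1 - real x / real D\<close>.\<close>
  have "?E (\<lambda>x. \<Sum>k<m. 1 - real x / real D) = ?E (\<lambda>x. real m - real m * (real x / real D))"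
    by (simp add: algebra_simps)
  also have "\<dots> = real m - real m * ?\<mu>"
    by (subst Bochner_Integration.integral_diff) (simp_all add: int mean_rew_def)
  finally have "E2 = {Y. m \<le> length (plays (h Y) i) \<and>
       (\<Sum>k<m. 1 - real (?x Y k) / real D) \<ge> ?E (\<lambda>x. \<Sum>k<m. 1 - real x / real D) + ?rad}"
    unfolding E2_def by (auto simp: sum_subtractf algebra_simps)
  then have E2: "measure_pmf.prob ?M E2 \<le> 1 / real T ^ 4"
    using hoeff[of "\<lambda>_ x. 1 - real x / real D"] le1 by simp
  have E3: "measure_pmf.prob ?M (E3 j) \<le> 1 / real T ^ 4" if j: "j \<in> {1..K}" for j
  proof -
    \<comment> \<open>The mean of the truncated sum lies below the centre used in \<open>E3\<close>,
      so \<open>E3 j\<close> is contained in a Hoeffding event.\<close>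
    have "?E (\<lambda>x. \<Sum>k<m. trunc_rew D j (m - Suc k) x)
        \<le> ?E (\<lambda>x. real m * (real x / real D) + 1 + real x / real j)"
      using j by (intro integral_mono int sum_trunc_rew_le) auto
    also have "\<dots> = real m * ?\<mu> + 1 + ?E real / real j"
      by (simp add: int mean_rew_def)
    also have "?E real = real D * ?\<mu>" using D by (simp add: mean_rew_def)
    finally have "E3 j \<subseteq> {Y. m \<le> length (plays (h Y) i) \<and>
       (\<Sum>k<m. trunc_rew D j (m - Suc k) (?x Y k))
          \<ge> ?E (\<lambda>x. \<Sum>k<m. trunc_rew D j (m - Suc k) x) + ?rad}" (is "_ \<subseteq> ?F")
      unfolding E3_def by auto
    then have "measure_pmf.prob ?M (E3 j) \<le> measure_pmf.prob ?M ?F"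
      by (intro measure_pmf.finite_measure_mono) auto
    also have "\<dots> \<le> 1 / real T ^ 4"
      using hoeff[of "\<lambda>k x. trunc_rew D j (m - Suc k) x"] le1 by (simp add: trunc_rew_def)
    finally show ?thesis .
  qed
  have "bad_event T K D Dist h i m = (E1 \<union> E2) \<union> (\<Union>j\<in>{1..K}. E3 j)"
    by (simp add: bad_event_def E1_def E2_def E3_def Let_def)
  then have "measure_pmf.prob ?M (bad_event T K D Dist h i m)
      \<le> measure_pmf.prob ?M (E1 \<union> E2) + measure_pmf.prob ?M (\<Union>j\<in>{1..K}. E3 j)"
    by (simp add: measure_Un_le)
  also have "measure_pmf.prob ?M (E1 \<union> E2) \<le> measure_pmf.prob ?M E1 + measure_pmf.prob ?M E2"
    by (simp add: measure_Un_le)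
  also have "measure_pmf.prob ?M (\<Union>j\<in>{1..K}. E3 j) \<le> (\<Sum>j\<in>{1..K}. measure_pmf.prob ?M (E3 j))"
    by (intro measure_pmf.finite_measure_subadditive_finite) auto
  also have "\<dots> \<le> (\<Sum>j\<in>{1..K}. 1 / real T ^ 4)" by (intro sum_mono E3)
  finally show ?thesis using E1 E2 by (simp add: add_divide_distrib)
qed

lemma sum_list_eq_sum_plays:
  fixes f :: "nat \<Rightarrow> real"
  assumes "set h \<subseteq> I" "finite I"
  shows "(\<Sum>i\<leftarrow>h. f i) = (\<Sum>i\<in>I. real (length (plays h i)) * f i)"
  using assms(1)
proof (induction h)
  case (Cons x xs)
  have "(\<Sum>i\<in>I. real (length (plays (x # xs) i)) * f i)
      = (\<Sum>i\<in>I. real (length (plays xs i)) * f i + (if x = i then f i else 0))"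
    by (intro sum.cong) (auto simp: length_plays algebra_simps)
  also have "\<dots> = (\<Sum>i\<in>I. real (length (plays xs i)) * f i) + f x"
    using Cons.prems assms(2) by (simp add: sum.distrib)
  finally show ?case using Cons by simp
qed simp

context rse_run begin

lemma set_H: "set (H r) \<subseteq> {1..K}"
proof (induction r)
  case (Suc r)
  then show ?case using S_subset[of r] by (auto simp: H_Suc)
qed simp

section \<open>Horizons that allow at most one round\<close>

lemma H_one: "T \<ge> 2 \<Longrightarrow> length (H 1) = K"
  using H_Suc[of 0] by (simp add: act_def rse_state_def)

lemma H_short:
  assumes "T \<le> 1" shows "H T = []"
proof -
  have "\<not> act 0" using assms by (simp add: act_def)
  then have "\<not> act r" for r using act_mono[of r 0] by auto
  then have "H r = []" for r by (induction r) (auto simp: H_Suc)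
  then show ?thesis .
qed

lemma length_plays_single_round:
  assumes "2 \<le> T" "T \<le> K + 1" shows "length (plays (H T) i) \<le> 1"
proof -
  have "\<not> act 1" using H_one assms by (simp add: act_def)
  then show ?thesis using less_length_plays[of 1 T i] by auto
qed

end

section \<open>From good delay tables to the expected regret\<close>

theorem theorem4:
  fixes T K D :: nat and B :: real and Dist :: "nat \<Rightarrow> nat pmf"
  assumes "K \<ge> 2" and "D \<ge> 1"
    and "\<forall>i\<in>{1..K}. set_pmf (Dist i) \<subseteq> {0..D}"
    and "\<exists>!i. i \<in> {1..K} \<and> mean_rew D Dist i = mu_star K D Dist"
    and "B \<ge> mu_star K D Dist / 2"
  shows "rse_regret T K D B Dist
     \<le> (\<Sum>i\<in>{i\<in>{1..K}. gap K D Dist i > 0}. 289 * ln (real T) / gap K D Dist i)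
       + 12 * min (dbar K D Dist) (real D * gap_max K D Dist) * ln (real K)"
proof -
  let ?\<mu> = "mean_rew D Dist" and ?gap = "gap K D Dist" and ?h = "rse_history T K D B"
  define A where "A = {i \<in> {1..K}. ?gap i > 0}"
  define L where "L = ln (real T)"
  define M where "M = min (dbar K D Dist) (real D * gap_max K D Dist)"
  define Tab where "Tab = {1..T + K} \<times> {1..K}"
  have K: "K \<ge> 1" "{1..K} \<noteq> {}" using assms(1) by auto
  have A: "finite A" "A \<subseteq> {1..K}" by (auto simp: A_def)
  have mu_le: "?\<mu> i \<le> mu_star K D Dist" if "i \<in> {1..K}" for i
    unfolding mu_star_def using that by (intro Max_ge) auto
  have fin: "finite (set_pmf (Dist i))" if "i \<in> {1..K}" for i
    using assms(3) that finite_subset by blast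
  have mu01: "0 \<le> ?\<mu> i \<and> ?\<mu> i \<le> 1" if "i \<in> {1..K}" for i
  proof -
    have "?\<mu> i \<le> measure_pmf.expectation (Dist i) (\<lambda>_. 1)"
      unfolding mean_rew_def
      by (rule integral_mono_AE) (use assms that integrable_measure_pmf_finite[OF fin[OF that]] in
        \<open>auto simp: AE_measure_pmf_iff divide_le_eq subset_iff\<close>)
    moreover have "0 \<le> ?\<mu> i" unfolding mean_rew_def by (rule integral_nonneg_AE) simp
    ultimately show ?thesis by simp
  qed
  obtain star where star: "star \<in> {1..K}" "?\<mu> star = mu_star K D Dist"
    and mu_star_eq: "mu_star K D Dist = ?\<mu> star"
    and uniq: "\<And>i. i \<in> {1..K} \<Longrightarrow> ?\<mu> i = mu_star K D Dist \<Longrightarrow> i = star"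
    using assms(4) by metis
  have gap01: "0 \<le> ?gap i" "?gap i \<le> 1" if "i \<in> {1..K}" for i
    using mu_le[OF that] mu01[OF that] mu01[OF star(1)] star(2) by (auto simp: gap_def)
  have A_iff: "i \<in> A \<longleftrightarrow> i \<in> {1..K} \<and> i \<noteq> star" for i
    using mu_le[of i] uniq[of i] star by (force simp: A_def gap_def)
  have delay_max: "Max (mean_delay D Dist ` {1..K}) = real D * mu_star K D Dist"
  proof (rule Max_eqI)
    show "real D * mu_star K D Dist \<in> mean_delay D Dist ` {1..K}"
      using star by (metis imageI mean_delay_def)
  qed (use mu_le in \<open>auto simp: mean_delay_def intro!: mult_left_mono\<close>)
  have dbar: "real D * ?\<mu> i \<le> dbar K D Dist" if "i \<in> A" for i
    unfolding dbar_def
  proof (rule Max_ge)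
    show "real D * ?\<mu> i \<in> {mean_delay D Dist i |i. i \<in> {1..K} \<and> mean_delay D Dist i < Max (mean_delay D Dist ` {1..K})}"
      using that assms(2) unfolding delay_max by (auto simp: A_def gap_def mean_delay_def)
  qed simp
  have gap_max: "?gap i \<le> gap_max K D Dist" if "i \<in> {1..K}" for i
    unfolding gap_max_def using that by (intro Max_ge) auto
  have M_ge: "min (real D * ?\<mu> i) (real D * ?gap i) \<le> M" if "i \<in> A" for i
    unfolding M_def using dbar[OF that] gap_max[of i] A that
    by (intro min.mono mult_left_mono) auto
  \<comment> \<open>With at least two arms and a unique best one, a suboptimal arm exists; it
    witnesses \<open>M \<ge> 0\<close>.\<close>
  obtain i0 where i0: "i0 \<in> A"
  proof -
    have "card ({1..K} - {star}) \<noteq> 0" using star assms(1) by simp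
    then have "{1..K} - {star} \<noteq> {}" by (metis card.empty)
    then show ?thesis using that A_iff by blast
  qed
  have M0: "M \<ge> 0"
  proof -
    have "i0 \<in> {1..K}" using i0 A by blast
    then have "0 \<le> min (real D * ?\<mu> i0) (real D * ?gap i0)" using mu01 gap01 by simp
    then show ?thesis using M_ge[OF i0] by linarith
  qed
  have lnK: "ln (real K) \<ge> 0" using K by simp
  have run: "rse_run K" by unfold_locales (rule K)
  have hist: "?h Y = rse_run.H T K D B Y T" for Y
    by (simp add: rse_history_eq rse_run.H_def[OF run])
  have reg: "(\<Sum>i\<leftarrow>?h Y. ?gap i) = (\<Sum>i\<in>A. real (length (plays (?h Y) i)) * ?gap i)" for Y
  proof -
    have "(\<Sum>i\<leftarrow>?h Y. ?gap i) = (\<Sum>i\<in>{1..K}. real (length (plays (?h Y) i)) * ?gap i)"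
      unfolding hist by (rule sum_list_eq_sum_plays) (use rse_run.set_H[OF run] in auto)
    also have "\<dots> = (\<Sum>i\<in>A. real (length (plays (?h Y) i)) * ?gap i)"
      by (rule sum.mono_neutral_right) (use A star in \<open>auto simp: A_iff gap_def\<close>)
    finally show ?thesis .
  qed
  have table: "set_pmf (delay_table T K Dist) = PiE_dflt Tab 0 (set_pmf \<circ> (\<lambda>(t, i). Dist i))"
    unfolding delay_table_def Tab_def by (rule set_Pi_pmf) simp
  have fin_table: "finite (set_pmf (delay_table T K Dist))"
    unfolding table by (intro finite_PiE_dflt) (use fin in \<open>auto simp: Tab_def\<close>)
  note int = integrable_measure_pmf_finite[OF fin_table]
  have Y_le: "Y x \<le> D" if "Y \<in> set_pmf (delay_table T K Dist)" for Y x
  proof (cases "x \<in> Tab")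
    case True
    then obtain t i where x: "x = (t, i)" "i \<in> {1..K}" by (auto simp: Tab_def)
    then have "Y x \<in> set_pmf (Dist i)" using that True unfolding table PiE_dflt_def by auto
    then show ?thesis using assms(3) x(2) by force
  next
    case False
    then show ?thesis using that unfolding table PiE_dflt_def by (cases x) simp
  qed
  \<comment> \<open>Passage to expectations: a constant bound \<open>C\<close> on every table of the
    support, plus an excess \<open>E\<close> on the event \<open>bad\<close>.\<close>
  have pathwise: ?thesis
    if C: "\<And>Y. Y \<in> set_pmf (delay_table T K Dist) \<Longrightarrow>
      (\<Sum>i\<in>A. real (length (plays (?h Y) i)) * ?gap i) \<le> C + E * indicator bad Y"
      and prob: "E * measure_pmf.prob (delay_table T K Dist) bad \<le> E'"
      and E': "C + E' \<le> (\<Sum>i\<in>A. 289 * L / ?gap i) + 12 * M * ln (real K)"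
    for C E E' bad
  proof -
    have "rse_regret T K D B Dist \<le> measure_pmf.expectation (delay_table T K Dist) (\<lambda>Y. C + E * indicator bad Y)"
      unfolding rse_regret_def reg
      by (rule integral_mono_AE) (use C in \<open>auto simp: AE_measure_pmf_iff intro!: int\<close>)
    also have "\<dots> = C + E * measure_pmf.prob (delay_table T K Dist) bad"
      by (subst Bochner_Integration.integral_add) (auto intro!: int)
    finally show ?thesis using prob E' unfolding A_def L_def M_def by linarith
  qed
  \<comment> \<open>The union bound needs \<open>K + 2 \<le> T\<close>; shorter horizons allow at
    most one round and are settled directly.\<close>
  consider "T \<le> 1" | "2 \<le> T" "T \<le> K + 1" | "K + 2 \<le> T" using assms(1) by linarith
  then show ?thesis
  proof cases
    case 1
    \<comment> \<open>This includes \<open>T = 0\<close>, as \<open>ln 0 = 0\<close>.\<close>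
    then have "L = 0" by (cases T) (auto simp: L_def)
    moreover have "?h Y = []" for Y unfolding hist using rse_run.H_short[OF run 1] .
    ultimately show ?thesis
      using M0 lnK by (intro pathwise[of 0 0 "{}" 0]) auto
  next
    case 2
    then have "ln 2 \<le> L" by (simp add: L_def)
    then have L: "1 / 2 \<le> L" using ln2_ge_two_thirds by simp
    show ?thesis
    proof (rule pathwise[of "\<Sum>i\<in>A. ?gap i" 0 "{}" 0])
      fix Y
      have "length (plays (?h Y) i) \<le> 1" for i
        unfolding hist using rse_run.length_plays_single_round[OF run 2] .
      then show "(\<Sum>i\<in>A. real (length (plays (?h Y) i)) * ?gap i) \<le> (\<Sum>i\<in>A. ?gap i) + 0 * indicator {} Y"
        using gap01 A by (auto intro!: sum_mono mult_left_le_one_le)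
    next
      have "?gap i \<le> 289 * L / ?gap i" if "i \<in> A" for i
      proof -
        have "0 < ?gap i" "?gap i \<le> 1" using that gap01(2)[of i] by (auto simp: A_def)
        then have "?gap i * ?gap i \<le> 1" by (simp add: mult_le_one)
        then show ?thesis using L \<open>0 < ?gap i\<close> by (simp add: pos_le_divide_eq)
      qed
      then show "(\<Sum>i\<in>A. ?gap i) + 0 \<le> (\<Sum>i\<in>A. 289 * L / ?gap i) + 12 * M * ln (real K)"
        using M0 lnK by (simp add: sum_mono add_increasing2)
    qed simp
  next
    case 3
    then have T: "T \<ge> 2" by simp
    then have "ln 2 \<le> L" by (simp add: L_def)
    then have L: "1 / 2 \<le> L" using ln2_ge_two_thirds by simp
    \<comment> \<open>An arm is played at most once per round, hence at most \<open>T\<close> times,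
      so these \<open>m\<close> cover all prefixes of its plays.\<close>
    define bad where "bad = (\<Union>(i, m)\<in>{1..K} \<times> {1..T}. bad_event T K D Dist ?h i m)"
    have "measure_pmf.prob (delay_table T K Dist) bad
        \<le> (\<Sum>(i, m)\<in>{1..K} \<times> {1..T}. measure_pmf.prob (delay_table T K Dist) (bad_event T K D Dist ?h i m))"
      unfolding bad_def case_prod_unfold
      by (intro measure_pmf.finite_measure_subadditive_finite) auto
    also have "\<dots> \<le> (\<Sum>(i, m)\<in>{1..K} \<times> {1..T}. real (K + 2) / real T ^ 4)"
      unfolding case_prod_unfold
    proof (rule sum_mono)
      fix z assume z: "z \<in> {1..K} \<times> {1..T}"
      show "measure_pmf.prob (delay_table T K Dist) (bad_event T K D Dist ?h (fst z) (snd z)) \<le> real (K + 2) / real T ^ 4"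
        unfolding delay_table_def
        by (rule prob_bad_event[where L = "T + K"])
          (use z T assms nonanticipating_rse rse_run.length_H[OF run] in \<open>auto simp: hist\<close>)
    qed
    also have "\<dots> = (real K * real (K + 2)) * real T / real T ^ 4" by (simp add: case_prod_unfold)
    also have "\<dots> \<le> (real T * real T) * real T / real T ^ 4"
      using 3 by (intro divide_right_mono mult_right_mono mult_mono) auto
    also have "\<dots> = 1 / real T" using T by (simp add: power4_eq_xxxx)
    finally have prob: "measure_pmf.prob (delay_table T K Dist) bad \<le> 1 / real T" .
    let ?C = "(\<Sum>i\<in>A. 72 * L / ?gap i + 7) + 12 * M * ln (real K)"
    show ?thesis
    \<comment> \<open>On the bad event each suboptimal arm is charged \<open>T\<close> plays; its
      probability of at most \<open>1 / real T\<close> reduces this to the sum of the gaps.\<close>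
    proof (rule pathwise[of ?C "(\<Sum>i\<in>A. ?gap i) * real T" bad "\<Sum>i\<in>A. ?gap i"])
      fix Y assume Y: "Y \<in> set_pmf (delay_table T K Dist)"
      have nonneg: "?C \<ge> 0"
        using M0 lnK L A by (intro add_nonneg_nonneg sum_nonneg) (auto simp: A_def)
      show "(\<Sum>i\<in>A. real (length (plays (?h Y) i)) * ?gap i) \<le> ?C + (\<Sum>i\<in>A. ?gap i) * real T * indicator bad Y"
      proof (cases "Y \<in> bad")
        case True
        have "length (plays (?h Y) i) \<le> T" for i
          unfolding hist by (rule rse_run.length_plays_le[OF run])
        then have "(\<Sum>i\<in>A. real (length (plays (?h Y) i)) * ?gap i) \<le> (\<Sum>i\<in>A. real T * ?gap i)"
          by (intro sum_mono mult_right_mono) (auto simp: A_def)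
        also have "\<dots> = (\<Sum>i\<in>A. ?gap i) * real T" by (simp add: sum_distrib_left mult.commute)
        finally show ?thesis using nonneg True by simp
      next
        case False
        interpret rse_run T K D B Y by (rule run)
        have nb: "Y \<notin> bad_event T K D Dist ?h i m" if "i \<in> {1..K}" "1 \<le> m" "m \<le> length (plays (H T) i)" for i m
          using False that length_plays_le[of T i] unfolding bad_def by auto
        have nth: "plays (H T) i ! k = pos i k" if "m \<le> length (plays (H T) i)" "k < m" for i k m
          by (subst plays_H) (use that in simp)
        have h: "?h Y = H T" by (rule hist)
        interpret rse_good T K D B Y ?\<mu> star
        proof unfold_locales
          fix i m assume im: "i \<in> {1..K}" "1 \<le> m" "m \<le> length (plays (H T) i)"
          show "\<bar>(\<Sum>k<m. real (X i k) / real D) - real m * ?\<mu> i\<bar> \<le> real m * sqrt (2 * ln (real T) / real m)"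
            using nb[OF im] im(3) nth[OF im(3)] by (auto simp: bad_event_def Let_def h)
          fix j assume "j \<in> {1..K}"
          then show "(\<Sum>k<m. trunc_rew D j (m - Suc k) (X i k))
            \<le> real m * ?\<mu> i + 1 + real D * ?\<mu> i / real j + real m * sqrt (2 * ln (real T) / real m)"
            using nb[OF im] im(3) nth[OF im(3)] by (auto simp: bad_event_def Let_def h not_le less_imp_le)
        qed (use T assms star mu_le mu01 Y_le[OF Y] in auto)
        have Aeq: "A = {i \<in> {1..K}. ?\<mu> i < ?\<mu> star}" by (simp add: A_def gap_def mu_star_eq)
        have "(\<Sum>i\<in>A. real (length (plays (H T) i)) * (?\<mu> star - ?\<mu> i))
          \<le> (\<Sum>i\<in>A. 72 * L / (?\<mu> star - ?\<mu> i) + 7) + 12 * M * ln (real K)"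
          unfolding Aeq L_def
        proof (rule regret_bound)
          fix i assume "i \<in> {i \<in> {1..K}. ?\<mu> i < ?\<mu> star}"
          then have "i \<in> A" by (simp add: Aeq)
          then show "min (real D * ?\<mu> i) (real D * (?\<mu> star - ?\<mu> i)) \<le> M"
            using M_ge by (simp add: gap_def mu_star_eq)
        qed (use assms(1) M0 in auto)
        then show ?thesis using False by (simp add: h gap_def mu_star_eq)
      qed
    next
      have "(\<Sum>i\<in>A. ?gap i) * real T * measure_pmf.prob (delay_table T K Dist) bad \<le> (\<Sum>i\<in>A. ?gap i) * real T * (1 / real T)"
        using prob by (intro mult_left_mono mult_nonneg_nonneg sum_nonneg) (auto simp: A_def)
      then show "(\<Sum>i\<in>A. ?gap i) * real T * measure_pmf.prob (delay_table T K Dist) bad \<le> (\<Sum>i\<in>A. ?gap i)"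
        using T by simp
    next
      \<comment> \<open>Since \<open>7 + ?gap i\<close> is at most 8 and \<open>L\<close> at least
        \<open>1 / 2\<close>, the remaining \<open>217 = 289 - 72\<close> absorbs the
        constants.\<close>
      have "72 * L / ?gap i + 7 + ?gap i \<le> 289 * L / ?gap i" if "i \<in> A" for i
      proof -
        have g: "0 < ?gap i" "?gap i \<le> 1" using that gap01(2)[of i] by (auto simp: A_def)
        then have "8 * ?gap i \<le> 217 * L" using L by linarith
        then have "8 \<le> 217 * L / ?gap i" using g by (simp add: pos_le_divide_eq)
        moreover have "289 * L / ?gap i = 72 * L / ?gap i + 217 * L / ?gap i"
          by (simp add: add_divide_distrib[symmetric])
        ultimately show ?thesis using g by linarith
      qed
      then have "(\<Sum>i\<in>A. 72 * L / ?gap i + 7 + ?gap i) \<le> (\<Sum>i\<in>A. 289 * L / ?gap i)"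
        by (rule sum_mono)
      then show "?C + (\<Sum>i\<in>A. ?gap i) \<le> (\<Sum>i\<in>A. 289 * L / ?gap i) + 12 * M * ln (real K)"
        by (simp add: sum.distrib)
    qed
  qed
qed

end
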